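(* Let $g$ be the Kerr-Newman-(anti-)de Sitter metric with real parameters $a,m,q,\Lambda$ (see context) and write $c=\cos\theta$. Then the invariant $I_4=\nabla_\mu C_{\alpha\beta\gamma\delta}\nabla^\mu C^{*\alpha\beta\gamma\delta}$ of $g$ equals $$\begin{aligned} I_4=\frac{1920\,a\,c}{(r^2+a^2c^2)^9}\Big(&a^{10}m\Lambda\big(mr-\tfrac{3q^2}{10}\big)c^{10}\\ &-a^8\Big(7\Lambda m^2r^3-\tfrac{57\Lambda mq^2r^2}{10}+\big[a^2m^2\Lambda+\tfrac{29}{30}q^4\Lambda-3m^2\big]r-\tfrac{3mq^2(\Lambda a^2-3)}{10}\Big)c^8\\ &+6a^6\Big(\Lambda m^2r^5-\tfrac{83mq^2r^4\Lambda}{60}+\big(a^2m^2\Lambda+\tfrac{37}{90}q^4\Lambda-3m^2\big)r^3-\tfrac{11(a^2\Lambda q^2+\frac{12}{11}m^2-3q^2)mr^2}{12}\\ &\qquad+\tfrac{29(a^2\Lambda q^2+\frac{126}{29}m^2-3q^2)q^2r}{180}+\tfrac{mq^2(a^2-2q^2)}{20}\Big)c^6\\ &+\tfrac{37a^4r}{10}\Big(\tfrac{60\Lambda m^2r^6}{37}-\tfrac{33r^5mq^2\Lambda}{37}+m\big(a^2\Lambda q^2+\tfrac{420}{37}m^2-3q^2\big)r^3-\tfrac{19(a^2\Lambda q^2+\frac{498}{19}m^2-3q^2)q^2r^2}{37}\\ &\qquad-\tfrac{27(a^2-\frac{178q^2}{27})mq^2r}{37}+\tfrac{12q^4a^2}{37}-\tfrac{17q^6}{37}\Big)c^4\\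 &-6a^2r^3\Big(\tfrac{7\Lambda m^2r^6}{6}-\tfrac{3r^5mq^2\Lambda}{2}+\big[a^2m^2\Lambda+\tfrac{37}{90}q^4\Lambda-3m^2\big]r^4-\tfrac{5m(a^2\Lambda q^2-\frac{28}{5}m^2-3q^2)r^3}{4}\\ &\qquad+\tfrac{19(a^2\Lambda q^2-\frac{750}{19}m^2-3q^2)q^2r^2}{60}+\tfrac{(a^2+\frac{418q^2}{15})mq^2r}{4}-\tfrac{37q^6}{30}\Big)c^2\\ &+r^5\Big(\Lambda m^2r^6-2r^5mq^2\Lambda+\big(a^2m^2\Lambda+\tfrac{29}{30}q^4\Lambda-3m^2\big)r^4-2m\big(a^2\Lambda q^2-3m^2-3q^2\big)r^3\\ &\qquad+\big(\tfrac{29}{30}a^2q^4\Lambda-15m^2q^2-\tfrac{29}{10}q^4\big)r^2+\tfrac{3mq^2(a^2+\frac{118q^2}{15})r}{2}-\tfrac{6q^4a^2}{5}-\tfrac{29q^6}{10}\Big)\Big). \end{aligned}$$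
   Context: Kerr-Newman-(anti-)de Sitter metric: in coordinates $(t,r,\theta,\phi)$, with signature $(-,+,+,+)$, $$ds^2=-\frac{\Delta_r}{\Xi^2\rho^2}(dt-a\sin^2\theta\,d\phi)^2+\frac{\rho^2}{\Delta_r}dr^2+\frac{\rho^2}{\Delta_\theta}d\theta^2+\frac{\Delta_\theta\sin^2\theta}{\Xi^2\rho^2}\big(a\,dt-(r^2+a^2)d\phi\big)^2,$$ $\Delta_\theta=1+\frac{a^2\Lambda}{3}\cos^2\theta$, $\Xi=1+\frac{a^2\Lambda}{3}$, $\Delta_r=(1-\frac{\Lambda}{3}r^2)(r^2+a^2)-2mr+q^2$, $\rho^2=r^2+a^2\cos^2\theta$. Here $a,m,q,\Lambda$ are the Kerr (rotation) parameter, mass, electric charge and cosmological constant. The identity is on the domain where the metric is regular ($\rho^2\ne0$, $\Delta_r\neq0$, $\Delta_\theta>0$, $\Xi\ne0$, $0<\theta<\pi$). $C_{\alpha\beta\gamma\delta}$ is the Weyl tensor and $\nabla$ the Levi-Civita connection of $g$; the dual Weyl tensor is $C^*_{\alpha\beta\gamma\delta}=\frac12E_{\alpha\beta\kappa\lambda}C^{\kappa\lambda}{}_{\gamma\delta}$, where $E$ is the Levi-Civita pseudotensor, oriented so that $E_{tr\theta\phi}=+\sqrt{-\det g}$. *)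

theory Defs
  imports "HOL-Analysis.Analysis"
begin

text \<open>
  Tensor calculus on (open subsets of) a four-dimensional coordinate chart. Points are vectors of
  coordinates, a metric is its field of component matrices, and tensor fields are given by
  their components. Conventions:
  \<^item> \<open>christoffel g x l i j\<close> is $\Gamma^l{}_{ij}$;
  \<^item> \<open>riemann_up g x l s i j\<close> is
    $R^l{}_{sij} = \partial_i\Gamma^l{}_{js} - \partial_j\Gamma^l{}_{is} + \ldots$, and
    $R_{sj} = R^l{}_{slj}$;
  \<^item> in \<open>cov_deriv\<close> the first index is the one of the derivative.
\<close>

type_synonym metric = "real^4 \<Rightarrow> real^4^4"
type_synonym tensor4 = "real^4 \<Rightarrow> 4 \<Rightarrow> 4 \<Rightarrow> 4 \<Rightarrow> 4 \<Rightarrow> real"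

definition partial_deriv :: "4 \<Rightarrow> (real^4 \<Rightarrow> real) \<Rightarrow> real^4 \<Rightarrow> real" where
  "partial_deriv i f x = deriv (\<lambda>s. f (\<chi> j. if j = i then s else x $ j)) (x $ i)"

definition inv_metric :: "metric \<Rightarrow> metric" where
  "inv_metric g x = matrix_inv (g x)"

definition christoffel :: "metric \<Rightarrow> real^4 \<Rightarrow> 4 \<Rightarrow> 4 \<Rightarrow> 4 \<Rightarrow> real" where
  "christoffel g x l i j = (\<Sum>s\<in>UNIV. 1/2 * inv_metric g x $ l $ s *
     (partial_deriv i (\<lambda>y. g y $ s $ j) x + partial_deriv j (\<lambda>y. g y $ s $ i) x
      - partial_deriv s (\<lambda>y. g y $ i $ j) x))"

definition riemann_up :: "metric \<Rightarrow> tensor4" where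
  "riemann_up g x l s i j =
     partial_deriv i (\<lambda>y. christoffel g y l j s) x - partial_deriv j (\<lambda>y. christoffel g y l i s) x
     + (\<Sum>k\<in>UNIV. christoffel g x l i k * christoffel g x k j s
                 - christoffel g x l j k * christoffel g x k i s)"

definition riemann :: "metric \<Rightarrow> tensor4" where
  "riemann g x l s i j = (\<Sum>k\<in>UNIV. g x $ l $ k * riemann_up g x k s i j)"

definition ricci :: "metric \<Rightarrow> real^4 \<Rightarrow> 4 \<Rightarrow> 4 \<Rightarrow> real" where
  "ricci g x i j = (\<Sum>l\<in>UNIV. riemann_up g x l i l j)"

definition scalar_curv :: "metric \<Rightarrow> real^4 \<Rightarrow> real" where
  "scalar_curv g x = (\<Sum>i\<in>UNIV. \<Sum>j\<in>UNIV. inv_metric g x $ i $ j * ricci g x i j)"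

text \<open>The constants 1/2 and 1/6 are $1/(n-2)$ and $1/((n-1)(n-2))$ for $n = 4$.\<close>

definition weyl :: "metric \<Rightarrow> tensor4" where
  "weyl g x i j k l = riemann g x i j k l
     - 1/2 * (g x $ i $ k * ricci g x j l - g x $ i $ l * ricci g x j k
              - g x $ j $ k * ricci g x i l + g x $ j $ l * ricci g x i k)
     + 1/6 * scalar_curv g x * (g x $ i $ k * g x $ j $ l - g x $ i $ l * g x $ j $ k)"

text \<open>
  The determinant of a matrix of unit row vectors is the totally antisymmetric symbol with
  value 1 at (1,2,3,4); so the coordinates, in this order, are positively oriented.
\<close>

definition levi_civita :: "metric \<Rightarrow> tensor4" where
  "levi_civita g x i j k l =
     sqrt (- det (g x)) * det (vector [axis i 1, axis j 1, axis k 1, axis l 1] :: real^4^4)"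

definition dual_weyl :: "metric \<Rightarrow> tensor4" where
  "dual_weyl g x i j k l = 1/2 * (\<Sum>u\<in>UNIV. \<Sum>v\<in>UNIV. levi_civita g x i j u v *
     (\<Sum>u'\<in>UNIV. \<Sum>v'\<in>UNIV.
        inv_metric g x $ u $ u' * inv_metric g x $ v $ v' * weyl g x u' v' k l))"

definition cov_deriv ::
  "metric \<Rightarrow> tensor4 \<Rightarrow> real^4 \<Rightarrow> 4 \<Rightarrow> 4 \<Rightarrow> 4 \<Rightarrow> 4 \<Rightarrow> 4 \<Rightarrow> real" where
  "cov_deriv g T x u i j k l = partial_deriv u (\<lambda>y. T y i j k l) x
     - (\<Sum>s\<in>UNIV. christoffel g x s u i * T x s j k l + christoffel g x s u j * T x i s k l
                 + christoffel g x s u k * T x i j s l + christoffel g x s u l * T x i j k s)"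

definition I4 :: "metric \<Rightarrow> real^4 \<Rightarrow> real" where
  "I4 g x = (\<Sum>u\<in>UNIV. \<Sum>i\<in>UNIV. \<Sum>j\<in>UNIV. \<Sum>k\<in>UNIV. \<Sum>l\<in>UNIV.
     cov_deriv g (weyl g) x u i j k l *
     (\<Sum>u'\<in>UNIV. \<Sum>i'\<in>UNIV. \<Sum>j'\<in>UNIV. \<Sum>k'\<in>UNIV. \<Sum>l'\<in>UNIV.
        inv_metric g x $ u $ u' * inv_metric g x $ i $ i' * inv_metric g x $ j $ j' *
        inv_metric g x $ k $ k' * inv_metric g x $ l $ l' *
        cov_deriv g (dual_weyl g) x u' i' j' k' l'))"

text \<open>
  Coordinates $(t,r,\theta,\phi)$ are numbered 1, 2, 3, 4. \<open>rho_sq\<close> is $\rho^2$.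
\<close>

definition Delta_theta :: "real \<Rightarrow> real \<Rightarrow> real \<Rightarrow> real" where
  "Delta_theta a \<Lambda> \<theta> = 1 + a^2 * \<Lambda> / 3 * (cos \<theta>)^2"

definition Xi :: "real \<Rightarrow> real \<Rightarrow> real" where
  "Xi a \<Lambda> = 1 + a^2 * \<Lambda> / 3"

definition Delta_r :: "real \<Rightarrow> real \<Rightarrow> real \<Rightarrow> real \<Rightarrow> real \<Rightarrow> real" where
  "Delta_r a m q \<Lambda> r = (1 - \<Lambda> / 3 * r^2) * (r^2 + a^2) - 2 * m * r + q^2"

definition rho_sq :: "real \<Rightarrow> real \<Rightarrow> real \<Rightarrow> real" where
  "rho_sq a r \<theta> = r^2 + a^2 * (cos \<theta>)^2"

text \<open>
  \<open>\<omega>\<close> and \<open>\<eta>\<close> are the components of the one-forms $dt - a \sin^2\theta\, d\phi$ and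
  $a\, dt - (r^2+a^2)\, d\phi$, and \<open>axis 2 1\<close>, \<open>axis 3 1\<close> those of $dr$, $d\theta$.
\<close>

definition kn_metric :: "real \<Rightarrow> real \<Rightarrow> real \<Rightarrow> real \<Rightarrow> metric" where
  "kn_metric a m q \<Lambda> x =
    (let r = x $ 2; \<theta> = x $ 3;
         \<omega> = vector [1, 0, 0, - a * (sin \<theta>)^2] :: real^4;
         \<eta> = vector [a, 0, 0, - (r^2 + a^2)] :: real^4;
         dr = axis 2 1 :: real^4;
         d\<theta> = axis 3 1 :: real^4
     in \<chi> i j. - Delta_r a m q \<Lambda> r / ((Xi a \<Lambda>)^2 * rho_sq a r \<theta>) * (\<omega> $ i * \<omega> $ j)
              + rho_sq a r \<theta> / Delta_r a m q \<Lambda> r * (dr $ i * dr $ j)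
              + rho_sq a r \<theta> / Delta_theta a \<Lambda> \<theta> * (d\<theta> $ i * d\<theta> $ j)
              + Delta_theta a \<Lambda> \<theta> * (sin \<theta>)^2 / ((Xi a \<Lambda>)^2 * rho_sq a r \<theta>)
                * (\<eta> $ i * \<eta> $ j))"

end

theory Submission
  imports Defs
begin

text \<open>
  In the coframe $(dt-a\sin^2\theta\,d\phi)/\Xi$, $dr$, $dx$ with $x=\cos\theta$, $(a\,dt-(r^2+a^2)\,d\phi)/\Xi$
  the metric is diagonal with entries $-Q/R$, $R/Q$, $R/X$, $X/R$, where $Q=\Delta_r$, $R=\rho^2$ and
  $X=(1-x^2)\Delta_\theta$. So $\Xi$, the square roots of an orthonormal frame and all trigonometric functions
  disappear, and every frame component is a rational function of $r$ and $x$.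

  The Weyl tensor is of type D: for the bivectors $Z=e^1\wedge e^2$ and $Z'=e^3\wedge e^4$ it is
  $P\,(K+3(Z\otimes Z-Z'\otimes Z'))+N\,(E-3(Z\otimes Z'+Z'\otimes Z))$ with $K_{abcd}=g_{ac}g_{bd}-g_{ad}g_{bc}$,
  $P+iN=(r+iax)^2(q^2-m(r+iax))/R^3$, and taking the dual replaces $(P,N)$ by $(-N,P)$. Since $K$ and $E$ are
  parallel, $\nabla C$ involves only $dP$, $dN$, $\nabla Z$ and $\nabla Z'=-{*}\nabla Z$, so the contraction is
  $I_4=-96\,dP\cdot dN+144\,((P^2-N^2)\,\nabla Z\cdot\nabla Z'+2PN\,\nabla Z\cdot\nabla Z)$
  for suitably normalized inner products, and both connection terms are multiples of $(Q-a^2X)/R^3$.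
\<close>

text \<open>With zeta = r + iax, Psi = P + iN equals (q^2 - m zeta) / (zeta conj(zeta)^3), the
  Newman-Penrose scalar Psi_2 of the charged rotating hole; it does not contain Lambda. Duality is
  multiplication of Psi by i, and I_4 is the imaginary part of -48 ((d Psi)^2 + 6 (Q - a^2 X) Psi^2
  zeta^2 / R^3), with the square of d Psi taken bilinearly. The obstacle is size: \<open>I4\<close>
  has ten index sums over third derivatives of the metric. Hence coordinates are traded for the
  frame by general lemmas, and the explicit functions enter only pointwise, as independent numbers
  subject to relations such as R R' = 1, so that each check is a polynomial identity. The frame is
  orthogonal but not orthonormal. Since \<open>G 1 * G 2\<close> and \<open>G 3 * G 4\<close> are
  the constants -1 and 1, the forms Z, Z' and E still have constant components although
  \<open>G\<close> varies. The connection is not derived: vanishing torsion and compatibility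
  determine it, so a table of its entries only has to be verified.\<close>

definition shift :: "real^4 \<Rightarrow> 4 \<Rightarrow> real \<Rightarrow> real^4" where
  "shift x i s = (\<chi> j. if j = i then s else x $ j)"

text \<open>\<open>deriv\<close> has some value even where a function is not differentiable. The
  relational form carries differentiability along, so that the sum and product rules can be
  chained.\<close>

definition has_partial :: "(real^4 \<Rightarrow> real) \<Rightarrow> real \<Rightarrow> 4 \<Rightarrow> real^4 \<Rightarrow> bool" where
  "has_partial f D i x \<longleftrightarrow> ((\<lambda>s. f (shift x i s)) has_field_derivative D) (at (x $ i))"

lemma shift_self [simp]: "shift x i (x $ i) = x"
  by (simp add: shift_def vec_eq_iff)

lemma partial_deriv_eq: "has_partial f D i x \<Longrightarrow> partial_deriv i f x = D"
  by (simp add: has_partial_def partial_deriv_def shift_def DERIV_imp_deriv)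

lemma continuous_shift: "continuous (at s) (shift x i)"
proof -
  have "shift x i = (\<lambda>s. x + (s - x $ i) *\<^sub>R axis i 1)"
    by (auto simp: shift_def vec_eq_iff axis_def fun_eq_iff)
  then show ?thesis by simp
qed

text \<open>Frame identities are available only on an open set; since a coordinate line stays in it
  for a short time, they may be differentiated.\<close>

lemma eventually_shift:
  assumes "open U" "x \<in> U"
  shows "eventually (\<lambda>s. shift x i s \<in> U) (nhds (x $ i))"
proof -
  have "isCont (shift x i) (x $ i)" by (rule continuous_shift)
  then have "filterlim (shift x i) (nhds x) (nhds (x $ i))"
    using tendsto_at_iff_tendsto_nhds[of "shift x i" "x $ i"] by (simp add: continuous_at)
  then show ?thesis
    using assms eventually_nhds_in_open unfolding filterlim_iff by blast
qed

lemma has_partial_cong: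
  assumes "open U" "x \<in> U" "\<And>y. y \<in> U \<Longrightarrow> f y = g y"
  shows "has_partial f D i x \<longleftrightarrow> has_partial g D i x"
  unfolding has_partial_def
  by (rule DERIV_cong_ev[OF refl _ refl], rule eventually_mono[OF eventually_shift[OF assms(1,2)]])
     (simp add: assms(3))

lemma partial_deriv_cong:
  assumes "open U" "x \<in> U" "\<And>y. y \<in> U \<Longrightarrow> f y = g y"
  shows "partial_deriv i f x = partial_deriv i g x"
proof -
  have "partial_deriv i h x = deriv (\<lambda>s. h (shift x i s)) (x $ i)" for h
    by (simp add: partial_deriv_def shift_def)
  then show ?thesis
    by (simp, intro deriv_cong_ev refl eventually_mono[OF eventually_shift[OF assms(1,2)]])
       (simp add: assms(3))
qed

lemma has_partial_unique: "has_partial f D i x \<Longrightarrow> has_partial f D' i x \<Longrightarrow> D = D'"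
  unfolding has_partial_def by (rule DERIV_unique)

named_theorems partial_intros

lemma has_partial_const [partial_intros]: "has_partial (\<lambda>y. c) 0 i x"
  by (simp add: has_partial_def)

lemma has_partial_add [partial_intros]:
  "has_partial f D i x \<Longrightarrow> has_partial g D' i x \<Longrightarrow> has_partial (\<lambda>y. f y + g y) (D + D') i x"
  unfolding has_partial_def by (rule DERIV_add)

lemma has_partial_diff [partial_intros]:
  "has_partial f D i x \<Longrightarrow> has_partial g D' i x \<Longrightarrow> has_partial (\<lambda>y. f y - g y) (D - D') i x"
  unfolding has_partial_def by (rule DERIV_diff)

lemma has_partial_mult [partial_intros]:
  "has_partial f D i x \<Longrightarrow> has_partial g D' i x \<Longrightarrow>
    has_partial (\<lambda>y. f y * g y) (D * g x + f x * D') i x"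
  unfolding has_partial_def by (drule (1) DERIV_mult) (simp add: mult.commute)

lemma has_partial_sum [partial_intros]:
  "(\<And>a. a \<in> A \<Longrightarrow> has_partial (f a) (D a) i x) \<Longrightarrow>
    has_partial (\<lambda>y. \<Sum>a\<in>A. f a y) (\<Sum>a\<in>A. D a) i x"
  unfolding has_partial_def by (rule DERIV_sum)

lemma has_partial_eq_rhs: "has_partial f D i x \<Longrightarrow> D = D' \<Longrightarrow> has_partial f D' i x"
  by simp

section \<open>Cartan calculus in a moving frame\<close>

text \<open>
  \<open>E y a i\<close> is $e^a{}_i$ and \<open>F y i a\<close> the dual frame; \<open>G\<close> lists the diagonal of the frame metric, which need
  not be constant. \<open>\<gamma> y e c d\<close> is $\gamma_e{}^c{}_d$ with $\nabla_e e^c=-\gamma_e{}^c{}_d\,e^d$. In \<open>dG\<close> and \<open>d\<gamma>\<close> the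
  first index is that of a frame derivative, in \<open>dE\<close>, \<open>ddE\<close> and \<open>dF\<close> that of a coordinate derivative.
\<close>

locale moving_frame =
  fixes g :: metric and U :: "(real^4) set"
    and E :: "real^4 \<Rightarrow> 4 \<Rightarrow> 4 \<Rightarrow> real" and dE :: "real^4 \<Rightarrow> 4 \<Rightarrow> 4 \<Rightarrow> 4 \<Rightarrow> real"
    and ddE :: "real^4 \<Rightarrow> 4 \<Rightarrow> 4 \<Rightarrow> 4 \<Rightarrow> 4 \<Rightarrow> real"
    and F :: "real^4 \<Rightarrow> 4 \<Rightarrow> 4 \<Rightarrow> real" and dF :: "real^4 \<Rightarrow> 4 \<Rightarrow> 4 \<Rightarrow> 4 \<Rightarrow> real"
    and G :: "real^4 \<Rightarrow> 4 \<Rightarrow> real" and dG :: "real^4 \<Rightarrow> 4 \<Rightarrow> 4 \<Rightarrow> real"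
    and \<gamma> :: "real^4 \<Rightarrow> 4 \<Rightarrow> 4 \<Rightarrow> 4 \<Rightarrow> real" and d\<gamma> :: "real^4 \<Rightarrow> 4 \<Rightarrow> 4 \<Rightarrow> 4 \<Rightarrow> 4 \<Rightarrow> real"
  assumes open_U: "open U"
    and metric: "y \<in> U \<Longrightarrow> g y $ i $ j = (\<Sum>a\<in>UNIV. G y a * E y a i * E y a j)"
    and G_nonzero: "y \<in> U \<Longrightarrow> G y a \<noteq> 0"
    and F_E: "y \<in> U \<Longrightarrow> (\<Sum>a\<in>UNIV. F y i a * E y a j) = (if i = j then 1 else 0)"
    and dE: "y \<in> U \<Longrightarrow> has_partial (\<lambda>y. E y a i) (dE y j a i) j y"
    and ddE: "y \<in> U \<Longrightarrow> has_partial (\<lambda>y. dE y j a i) (ddE y k j a i) k y"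
    and ddE_sym: "y \<in> U \<Longrightarrow> ddE y k j a i = ddE y j k a i"
    and dF: "y \<in> U \<Longrightarrow> has_partial (\<lambda>y. F y i a) (dF y j i a) j y"
    and dG: "y \<in> U \<Longrightarrow> has_partial (\<lambda>y. G y a) (\<Sum>e\<in>UNIV. E y e j * dG y e a) j y"
    and d\<gamma>: "y \<in> U \<Longrightarrow> has_partial (\<lambda>y. \<gamma> y e c d) (\<Sum>f\<in>UNIV. E y f j * d\<gamma> y f e c d) j y"
    and torsion_free: "y \<in> U \<Longrightarrow> dE y i c j - dE y j c i =
      - (\<Sum>e\<in>UNIV. \<Sum>f\<in>UNIV. E y e i * E y f j * (\<gamma> y e c f - \<gamma> y f c e))"
    and compatible: "y \<in> U \<Longrightarrow>
      (if c = d then dG y e c else 0) = G y c * \<gamma> y e c d + G y d * \<gamma> y e d c"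
begin

text \<open>The connection one-forms, with a coordinate index \<open>i\<close> in the form
  slot.\<close>

definition A :: "real^4 \<Rightarrow> 4 \<Rightarrow> 4 \<Rightarrow> 4 \<Rightarrow> real" where
  "A y i c d = (\<Sum>e\<in>UNIV. E y e i * \<gamma> y e c d)"

definition dA :: "real^4 \<Rightarrow> 4 \<Rightarrow> 4 \<Rightarrow> 4 \<Rightarrow> 4 \<Rightarrow> real" where
  "dA y j i c d = (\<Sum>e\<in>UNIV. dE y j e i * \<gamma> y e c d + E y e i * (\<Sum>f\<in>UNIV. E y f j * d\<gamma> y f e c d))"

lemma has_partial_A: "y \<in> U \<Longrightarrow> has_partial (\<lambda>y. A y i c d) (dA y j i c d) j y"
  unfolding A_def dA_def by (intro partial_intros dE d\<gamma>)

lemma E_F: "y \<in> U \<Longrightarrow> (\<Sum>i\<in>UNIV. E y a i * F y i b) = (if a = b then 1 else 0)"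
proof -
  assume y: "y \<in> U"
  define M N :: "real^4^4" where "M = (\<chi> i a. F y i a)" and "N = (\<chi> a i. E y a i)"
  have "M ** N = mat 1"
    by (simp add: M_def N_def matrix_matrix_mult_def mat_def vec_eq_iff F_E[OF y])
  then have "N ** M = mat 1" by (simp add: matrix_left_right_inverse)
  then have "(N ** M) $ a $ b = (mat 1 :: real^4^4) $ a $ b" by simp
  then show ?thesis by (simp add: M_def N_def matrix_matrix_mult_def mat_def)
qed

lemma sum_E_sum_F:
  assumes "y \<in> U" shows "(\<Sum>i\<in>UNIV. E y a i * (\<Sum>b\<in>UNIV. F y i b * h b)) = h a"
proof -
  have "(\<Sum>i\<in>UNIV. E y a i * (\<Sum>b\<in>UNIV. F y i b * h b)) = (\<Sum>b\<in>UNIV. (\<Sum>i\<in>UNIV. E y a i * F y i b) * h b)"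
    by (simp add: sum_distrib_left sum_distrib_right mult.assoc) (rule sum.swap)
  also have "\<dots> = h a" by (simp add: E_F[OF assms] if_distrib[of "\<lambda>z. z * _"] cong: if_cong)
  finally show ?thesis .
qed

lemma sum_F_sum_E:
  assumes "y \<in> U" shows "(\<Sum>a\<in>UNIV. F y i a * (\<Sum>j\<in>UNIV. E y a j * h j)) = h i"
proof -
  have "(\<Sum>a\<in>UNIV. F y i a * (\<Sum>j\<in>UNIV. E y a j * h j)) = (\<Sum>j\<in>UNIV. (\<Sum>a\<in>UNIV. F y i a * E y a j) * h j)"
    by (simp add: sum_distrib_left sum_distrib_right mult.assoc) (rule sum.swap)
  also have "\<dots> = h i" by (simp add: F_E[OF assms] if_distrib[of "\<lambda>z. z * _"] cong: if_cong)
  finally show ?thesis .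
qed

lemma inv_metric_eq:
  assumes "y \<in> U" shows "inv_metric g y $ i $ j = (\<Sum>a\<in>UNIV. F y i a * F y j a / G y a)"
proof -
  define N :: "real^4^4" where "N = (\<chi> i j. \<Sum>a\<in>UNIV. F y i a * F y j a / G y a)"
  have "(\<Sum>k\<in>UNIV. g y $ i $ k * N $ k $ j) = (if i = j then 1 else 0)" for i j
  proof -
    have "(\<Sum>k\<in>UNIV. g y $ i $ k * N $ k $ j) =
       (\<Sum>k\<in>UNIV. \<Sum>a\<in>UNIV. G y a * E y a i * (E y a k * (\<Sum>b\<in>UNIV. F y k b * (F y j b / G y b))))"
      by (simp add: metric[OF assms] N_def sum_distrib_right mult.assoc)
    also have "\<dots> = (\<Sum>a\<in>UNIV. G y a * E y a i * (\<Sum>k\<in>UNIV. E y a k * (\<Sum>b\<in>UNIV. F y k b * (F y j b / G y b))))"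
      by (subst sum.swap) (simp add: sum_distrib_left)
    also have "\<dots> = (\<Sum>a\<in>UNIV. F y j a * E y a i)"
      unfolding sum_E_sum_F[OF assms] by (simp add: G_nonzero[OF assms] mult.commute)
    finally show ?thesis by (simp add: F_E[OF assms])
  qed
  then have "g y ** N = mat 1"
    by (simp add: matrix_matrix_mult_def mat_def vec_eq_iff)
  then have N: "g y ** N = mat 1 \<and> N ** g y = mat 1"
    by (simp add: matrix_left_right_inverse)
  then have "g y ** matrix_inv (g y) = mat 1 \<and> matrix_inv (g y) ** g y = mat 1"
    unfolding matrix_inv_def by (rule someI)
  with N have "matrix_inv (g y) = N"
    by (metis matrix_mul_assoc matrix_mul_lid matrix_mul_rid)
  then show ?thesis by (simp add: inv_metric_def N_def)
qed

lemma raise_E: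
  assumes "y \<in> U"
  shows "(\<Sum>j\<in>UNIV. inv_metric g y $ i $ j * (\<Sum>a\<in>UNIV. E y a j * h a)) = (\<Sum>a\<in>UNIV. F y i a * (h a / G y a))"
proof -
  have "(\<Sum>j\<in>UNIV. inv_metric g y $ i $ j * (\<Sum>a\<in>UNIV. E y a j * h a)) =
     (\<Sum>j\<in>UNIV. \<Sum>b\<in>UNIV. F y i b / G y b * (F y j b * (\<Sum>a\<in>UNIV. E y a j * h a)))"
    by (simp add: inv_metric_eq[OF assms] sum_distrib_right[where r="\<Sum>a\<in>UNIV. _ a"] mult.assoc)
  also have "\<dots> = (\<Sum>b\<in>UNIV. F y i b / G y b * (\<Sum>j\<in>UNIV. F y j b * (\<Sum>a\<in>UNIV. E y a j * h a)))"
    by (subst sum.swap) (simp add: sum_distrib_left)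
  also have "(\<lambda>b. \<Sum>j\<in>UNIV. F y j b * (\<Sum>a\<in>UNIV. E y a j * h a)) = h"
  proof
    fix b
    have "(\<Sum>j\<in>UNIV. F y j b * (\<Sum>a\<in>UNIV. E y a j * h a)) = (\<Sum>a\<in>UNIV. (\<Sum>j\<in>UNIV. E y a j * F y j b) * h a)"
      by (simp add: sum_distrib_left sum_distrib_right mult_ac) (rule sum.swap)
    also have "\<dots> = h b" by (simp add: E_F[OF assms] if_distrib[of "\<lambda>z. z * _"] cong: if_cong)
    finally show "(\<Sum>j\<in>UNIV. F y j b * (\<Sum>a\<in>UNIV. E y a j * h a)) = h b" .
  qed
  finally show ?thesis by simp
qed

text \<open>The coefficients forced by the tetrad postulate: the derivative of the coframe that
  corrects the coordinate index by \<open>Gam\<close> and the frame index by \<open>A\<close>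
  vanishes.\<close>

definition Gam :: "real^4 \<Rightarrow> 4 \<Rightarrow> 4 \<Rightarrow> 4 \<Rightarrow> real" where
  "Gam y l i j = (\<Sum>c\<in>UNIV. F y l c * (dE y i c j + (\<Sum>d\<in>UNIV. A y i c d * E y d j)))"

lemma E_Gam: "y \<in> U \<Longrightarrow> (\<Sum>l\<in>UNIV. E y c l * Gam y l i j) = dE y i c j + (\<Sum>d\<in>UNIV. A y i c d * E y d j)"
  unfolding Gam_def by (rule sum_E_sum_F)

lemma Gam_sym: assumes "y \<in> U" shows "Gam y l i j = Gam y l j i"
proof -
  have "dE y i c j + (\<Sum>d\<in>UNIV. A y i c d * E y d j) = dE y j c i + (\<Sum>d\<in>UNIV. A y j c d * E y d i)" for c
  proof -
    have "(\<Sum>e\<in>UNIV. \<Sum>f\<in>UNIV. E y e i * E y f j * \<gamma> y f c e) = (\<Sum>d\<in>UNIV. A y j c d * E y d i)"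
      by (simp add: A_def sum_distrib_left mult_ac)
    moreover have "(\<Sum>e\<in>UNIV. \<Sum>f\<in>UNIV. E y e i * E y f j * \<gamma> y e c f) = (\<Sum>d\<in>UNIV. A y i c d * E y d j)"
      by (subst sum.swap) (simp add: A_def sum_distrib_left mult_ac)
    ultimately show ?thesis
      using torsion_free[OF assms, of i c j] by (simp add: right_diff_distrib sum_subtractf)
  qed
  then show ?thesis by (simp add: Gam_def)
qed

text \<open>The metric is parallel for \<open>Gam\<close>: contracted with the frame,
  \<open>compatible\<close> turns the derivatives of \<open>G\<close> into connection terms, and
  those of \<open>E\<close> are absorbed by \<open>E_Gam\<close>.\<close>

lemma partial_metric:
  assumes "y \<in> U"
  shows "has_partial (\<lambda>y. g y $ i $ j) (\<Sum>l\<in>UNIV. g y $ l $ j * Gam y l u i + g y $ i $ l * Gam y l u j) u y"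
proof -
  have gG: "(\<Sum>l\<in>UNIV. g y $ i $ l * Gam y l u j) =
     (\<Sum>a\<in>UNIV. G y a * E y a i * (dE y u a j + (\<Sum>d\<in>UNIV. A y u a d * E y d j)))" for i j
    by (simp add: metric[OF assms] sum_distrib_right flip: E_Gam[OF assms])
       (subst sum.swap, simp add: sum_distrib_left mult_ac)
  have gs: "g y $ i $ l = g y $ l $ i" for i l by (simp add: metric[OF assms] mult_ac)
  have comp: "(if c = d then \<Sum>e\<in>UNIV. E y e u * dG y e c else 0) = G y c * A y u c d + G y d * A y u d c" for c d
  proof -
    have "G y c * A y u c d + G y d * A y u d c = (\<Sum>e\<in>UNIV. E y e u * (G y c * \<gamma> y e c d + G y d * \<gamma> y e d c))"
      by (simp add: A_def sum_distrib_left distrib_left sum.distrib mult_ac)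
    also have "\<dots> = (\<Sum>e\<in>UNIV. E y e u * (if c = d then dG y e c else 0))" by (simp add: compatible[OF assms])
    finally show ?thesis by simp
  qed
  have "has_partial (\<lambda>y. \<Sum>a\<in>UNIV. G y a * E y a i * E y a j)
     (\<Sum>a\<in>UNIV. ((\<Sum>e\<in>UNIV. E y e u * dG y e a) * E y a i + G y a * dE y u a i) * E y a j + G y a * E y a i * dE y u a j) u y"
    by (intro partial_intros dE dG assms)
  moreover have "(\<Sum>a\<in>UNIV. (\<Sum>e\<in>UNIV. E y e u * dG y e a) * E y a i * E y a j) =
    (\<Sum>a\<in>UNIV. G y a * E y a i * (\<Sum>d\<in>UNIV. A y u a d * E y d j)) + (\<Sum>a\<in>UNIV. G y a * E y a j * (\<Sum>d\<in>UNIV. A y u a d * E y d i))"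
  proof -
    have "(\<Sum>a\<in>UNIV. (\<Sum>e\<in>UNIV. E y e u * dG y e a) * E y a i * E y a j) =
       (\<Sum>a\<in>UNIV. \<Sum>d\<in>UNIV. (if a = d then \<Sum>e\<in>UNIV. E y e u * dG y e a else 0) * E y a i * E y d j)"
      by (simp add: if_distrib[of "\<lambda>z. z * _"] cong: if_cong)
    also have "\<dots> = (\<Sum>a\<in>UNIV. \<Sum>d\<in>UNIV. G y a * A y u a d * E y a i * E y d j) + (\<Sum>a\<in>UNIV. \<Sum>d\<in>UNIV. G y d * A y u d a * E y a i * E y d j)"
      by (simp only: comp distrib_right sum.distrib)
    also have "(\<Sum>a\<in>UNIV. \<Sum>d\<in>UNIV. G y d * A y u d a * E y a i * E y d j) = (\<Sum>d\<in>UNIV. \<Sum>a\<in>UNIV. G y d * A y u d a * E y a i * E y d j)"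
      by (rule sum.swap)
    finally show ?thesis by (simp add: sum_distrib_left mult_ac)
  qed
  ultimately have "has_partial (\<lambda>y. \<Sum>a\<in>UNIV. G y a * E y a i * E y a j)
     ((\<Sum>l\<in>UNIV. g y $ j $ l * Gam y l u i) + (\<Sum>l\<in>UNIV. g y $ i $ l * Gam y l u j)) u y"
    by (elim has_partial_eq_rhs, unfold gG) (simp add: distrib_left distrib_right sum.distrib mult_ac)
  then show ?thesis
    by (subst has_partial_cong[OF open_U assms metric]) (simp_all add: sum.distrib gs)
qed

text \<open>Uniqueness of the Levi-Civita connection. By \<open>partial_metric\<close> the bracket
  in \<open>christoffel\<close> consists of six lowered \<open>Gam\<close>; symmetry cancels four of
  them and makes the other two equal, which absorbs the factor 1/2.\<close>

theorem christoffel_eq: assumes "y \<in> U" shows "christoffel g y l i j = Gam y l i j"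
proof -
  let ?L = "\<lambda>s i j. \<Sum>m\<in>UNIV. g y $ s $ m * Gam y m i j"
  have gs: "g y $ i $ l = g y $ l $ i" for i l by (simp add: metric[OF assms] mult_ac)
  have Ls: "?L s i j = ?L s j i" for s i j by (simp add: Gam_sym[OF assms])
  have p: "partial_deriv u (\<lambda>y. g y $ i $ j) y = ?L j u i + ?L i u j" for u i j
    by (simp add: partial_deriv_eq[OF partial_metric[OF assms]] sum.distrib gs)
  have "christoffel g y l i j = (\<Sum>s\<in>UNIV. inv_metric g y $ l $ s * ?L s i j)"
    unfolding christoffel_def p Ls[of _ j] Ls[of _ _ i] by (simp add: Ls)
  also have "\<dots> = (\<Sum>s\<in>UNIV. inv_metric g y $ l $ s * (\<Sum>a\<in>UNIV. E y a s * (G y a * (\<Sum>m\<in>UNIV. E y a m * Gam y m i j))))"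
  proof -
    have "?L s i j = (\<Sum>a\<in>UNIV. E y a s * (G y a * (\<Sum>m\<in>UNIV. E y a m * Gam y m i j)))" for s
      by (simp add: metric[OF assms] sum_distrib_right)
         (subst sum.swap, simp add: sum_distrib_left mult_ac)
    then show ?thesis by simp
  qed
  also have "\<dots> = (\<Sum>a\<in>UNIV. F y l a * (\<Sum>m\<in>UNIV. E y a m * Gam y m i j))"
    by (simp add: raise_E[OF assms] G_nonzero[OF assms])
  finally show ?thesis by (simp add: sum_F_sum_E[OF assms])
qed

end

section \<open>Multilinear contraction with the frame\<close>

definition contract :: "('i::finite \<Rightarrow> real) \<Rightarrow> ('i \<Rightarrow> real) \<Rightarrow> real" where
  "contract v f = (\<Sum>a\<in>UNIV. v a * f a)"

lemma contract_add: "contract v (\<lambda>a. f a + h a) = contract v f + contract v h"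
  by (simp add: contract_def distrib_left sum.distrib)

lemma contract_diff: "contract v (\<lambda>a. f a - h a) = contract v f - contract v h"
  by (simp add: contract_def right_diff_distrib sum_subtractf)

lemma contract_sum: "contract v (\<lambda>a. \<Sum>s\<in>S. f s a) = (\<Sum>s\<in>S. contract v (f s))"
  unfolding contract_def by (subst sum.swap) (simp add: sum_distrib_left)

lemma contract_scale: "contract v (\<lambda>a. c * f a) = c * contract v f"
  unfolding contract_def sum_distrib_left by (rule sum.cong[OF refl]) simp

lemma contract_scale': "contract v (\<lambda>a. f a * c) = contract v f * c"
  unfolding contract_def sum_distrib_right by (rule sum.cong[OF refl]) simp

lemma contract_swap: "contract v (\<lambda>a. contract w (\<lambda>b. f a b)) = contract w (\<lambda>b. contract v (\<lambda>a. f a b))"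
  unfolding contract_def sum_distrib_left by (subst sum.swap) (simp add: mult_ac)

lemmas contract_linear = contract_add contract_diff contract_sum contract_scale contract_scale'

text \<open>Nested one-index contractions instead of one fourfold sum: linearity and exchange become
  rewrite rules that act on a single index and never expand a sum.\<close>

definition pull :: "(4 \<Rightarrow> 4 \<Rightarrow> real) \<Rightarrow> (4 \<Rightarrow> 4 \<Rightarrow> 4 \<Rightarrow> 4 \<Rightarrow> real) \<Rightarrow> 4 \<Rightarrow> 4 \<Rightarrow> 4 \<Rightarrow> 4 \<Rightarrow> real" where
  "pull E T i j k l = contract (\<lambda>a. E a i) (\<lambda>a. contract (\<lambda>b. E b j) (\<lambda>b. contract (\<lambda>c. E c k) (\<lambda>c. contract (\<lambda>d. E d l) (\<lambda>d. T a b c d))))"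

lemma pull_13_24:
  "pull E (\<lambda>a b c d. p a c * q b d) i j k l =
    contract (\<lambda>a. E a i) (\<lambda>a. contract (\<lambda>c. E c k) (p a)) * contract (\<lambda>b. E b j) (\<lambda>b. contract (\<lambda>d. E d l) (q b))"
  by (simp add: pull_def contract_scale contract_scale')

lemma pull_14_23:
  "pull E (\<lambda>a b c d. p a d * q b c) i j k l =
    contract (\<lambda>a. E a i) (\<lambda>a. contract (\<lambda>d. E d l) (p a)) * contract (\<lambda>b. E b j) (\<lambda>b. contract (\<lambda>c. E c k) (q b))"
  by (simp add: pull_def contract_scale contract_scale')

lemma sum_delta_mult [simp]:
  "(\<Sum>a\<in>UNIV. (if a = b then 1 else 0) * f a) = (f b :: real)" "(\<Sum>a\<in>UNIV. (if b = a then 1 else 0) * f a) = (f b :: real)"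
  for b :: "'i::finite"
  by (simp_all add: if_distrib[of "\<lambda>z. z * _"] cong: if_cong)

section \<open>Riemann, Ricci and Weyl tensors and covariant derivatives in frame components\<close>

context moving_frame begin

text \<open>The curvature two-forms of Cartan's second structure equation, with coordinate indices
  in the form slots.\<close>

definition \<Omega> :: "real^4 \<Rightarrow> 4 \<Rightarrow> 4 \<Rightarrow> 4 \<Rightarrow> 4 \<Rightarrow> real" where
  "\<Omega> y i j c d = dA y i j c d - dA y j i c d + (\<Sum>h\<in>UNIV. A y i c h * A y j h d - A y j c h * A y i h d)"

definition curv :: "real^4 \<Rightarrow> 4 \<Rightarrow> 4 \<Rightarrow> 4 \<Rightarrow> 4 \<Rightarrow> real" where
  "curv y c d e f = d\<gamma> y e f c d - d\<gamma> y f e c d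
     + (\<Sum>h\<in>UNIV. \<gamma> y e c h * \<gamma> y f h d - \<gamma> y f c h * \<gamma> y e h d)
     - (\<Sum>h\<in>UNIV. (\<gamma> y e h f - \<gamma> y f h e) * \<gamma> y h c d)"

text \<open>Differentiating \<open>E_Gam\<close> once more gives the curvature; the second derivatives of \<open>E\<close> cancel by symmetry.\<close>

lemma E_riemann_up:
  assumes x: "x \<in> U"
  shows "(\<Sum>l\<in>UNIV. E x c l * riemann_up g x l s i j) = (\<Sum>d\<in>UNIV. \<Omega> x i j c d * E x d s)"
proof -
  define D where "D l j s i = partial_deriv i (\<lambda>y. Gam y l j s) x" for l j s i
  have D: "has_partial (\<lambda>y. Gam y l j s) (D l j s i) i x" for l j s i
  proof -
    have "\<exists>D'. has_partial (\<lambda>y. Gam y l j s) D' i x"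
      unfolding Gam_def by (rule exI, rule has_partial_sum, rule has_partial_mult[OF dF[OF x]],
        rule has_partial_add[OF ddE[OF x]], rule has_partial_sum, rule has_partial_mult[OF has_partial_A[OF x] dE[OF x]])
    then show ?thesis by (auto simp: D_def partial_deriv_eq)
  qed
  have "(\<Sum>l\<in>UNIV. E x c l * D l j s i) + (\<Sum>l\<in>UNIV. E x c l * (\<Sum>k\<in>UNIV. Gam x l i k * Gam x k j s)) =
     ddE x i j c s + (\<Sum>d\<in>UNIV. A x j c d * dE x i d s + A x i c d * dE x j d s)
      + (\<Sum>d\<in>UNIV. (dA x i j c d + (\<Sum>h\<in>UNIV. A x i c h * A x j h d)) * E x d s)" for i j
  proof -
    have "has_partial (\<lambda>y. \<Sum>l\<in>UNIV. E y c l * Gam y l j s)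
       (\<Sum>l\<in>UNIV. dE x i c l * Gam x l j s + E x c l * D l j s i) i x"
      by (intro partial_intros dE D x)
    moreover have "has_partial (\<lambda>y. \<Sum>l\<in>UNIV. E y c l * Gam y l j s)
       (ddE x i j c s + (\<Sum>d\<in>UNIV. dA x i j c d * E x d s + A x j c d * dE x i d s)) i x"
      by (subst has_partial_cong[OF open_U x E_Gam]) (auto intro!: partial_intros dE ddE has_partial_A x)
    ultimately have 1: "(\<Sum>l\<in>UNIV. dE x i c l * Gam x l j s + E x c l * D l j s i) =
       (ddE x i j c s + (\<Sum>d\<in>UNIV. dA x i j c d * E x d s + A x j c d * dE x i d s))"
      by (rule has_partial_unique)
    have "(\<Sum>l\<in>UNIV. E x c l * (\<Sum>k\<in>UNIV. Gam x l i k * Gam x k j s)) =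
       (\<Sum>k\<in>UNIV. (\<Sum>l\<in>UNIV. E x c l * Gam x l i k) * Gam x k j s)"
      by (simp add: sum_distrib_left sum_distrib_right mult.assoc) (rule sum.swap)
    also have "\<dots> = (\<Sum>k\<in>UNIV. dE x i c k * Gam x k j s) + (\<Sum>k\<in>UNIV. (\<Sum>d\<in>UNIV. A x i c d * E x d k) * Gam x k j s)"
      by (simp add: E_Gam[OF x] distrib_right sum.distrib)
    also have "(\<Sum>k\<in>UNIV. (\<Sum>d\<in>UNIV. A x i c d * E x d k) * Gam x k j s) =
       (\<Sum>d\<in>UNIV. A x i c d * (\<Sum>k\<in>UNIV. E x d k * Gam x k j s))"
      by (simp add: sum_distrib_left sum_distrib_right mult.assoc) (rule sum.swap)
    also have "\<dots> = (\<Sum>d\<in>UNIV. A x i c d * dE x j d s) + (\<Sum>d\<in>UNIV. A x i c d * (\<Sum>h\<in>UNIV. A x j d h * E x h s))"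
      by (simp add: E_Gam[OF x] distrib_left sum.distrib)
    also have "(\<Sum>d\<in>UNIV. A x i c d * (\<Sum>h\<in>UNIV. A x j d h * E x h s)) = (\<Sum>d\<in>UNIV. (\<Sum>h\<in>UNIV. A x i c h * A x j h d) * E x d s)"
      by (simp add: sum_distrib_left sum_distrib_right mult.assoc) (rule sum.swap)
    finally show ?thesis using 1 by (simp add: sum.distrib distrib_right)
  qed
  note key = this
  have "partial_deriv i (\<lambda>y. christoffel g y l j s) x = D l j s i" for l j s i
    unfolding D_def by (rule partial_deriv_cong[OF open_U x]) (rule christoffel_eq)
  then have "riemann_up g x l s i j = D l j s i + (\<Sum>k\<in>UNIV. Gam x l i k * Gam x k j s)
      - (D l i s j + (\<Sum>k\<in>UNIV. Gam x l j k * Gam x k i s))" for l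
    by (simp add: riemann_up_def christoffel_eq[OF x] sum_subtractf)
  then have "(\<Sum>l\<in>UNIV. E x c l * riemann_up g x l s i j) =
     (\<Sum>l\<in>UNIV. E x c l * D l j s i) + (\<Sum>l\<in>UNIV. E x c l * (\<Sum>k\<in>UNIV. Gam x l i k * Gam x k j s))
     - ((\<Sum>l\<in>UNIV. E x c l * D l i s j) + (\<Sum>l\<in>UNIV. E x c l * (\<Sum>k\<in>UNIV. Gam x l j k * Gam x k i s)))"
    by (simp add: right_diff_distrib distrib_left sum.distrib sum_subtractf)
  also have "\<dots> = (\<Sum>d\<in>UNIV. \<Omega> x i j c d * E x d s)"
    unfolding key ddE_sym[OF x, of i j] \<Omega>_def
    by (simp add: sum.distrib sum_subtractf distrib_right left_diff_distrib)
  finally show ?thesis .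
qed

text \<open>The one contribution that is not a mere change of basis is the derivative of
  \<open>E\<close> inside \<open>dA\<close>. Its antisymmetric part is given by
  \<open>torsion_free\<close> and becomes the last sum of \<open>curv\<close>, which accounts for
  the brackets of the frame vectors.\<close>

lemma \<Omega>_eq:
  assumes x: "x \<in> U"
  shows "\<Omega> x i j c d = contract (\<lambda>e. E x e i) (\<lambda>e. contract (\<lambda>f. E x f j) (\<lambda>f. curv x c d e f))"
proof -
  have 1: "dA x i j c d - dA x j i c d = 
     (\<Sum>h\<in>UNIV. (dE x i h j - dE x j h i) * \<gamma> x h c d)
     + contract (\<lambda>e. E x e i) (\<lambda>e. contract (\<lambda>f. E x f j) (\<lambda>f. d\<gamma> x e f c d))
     - contract (\<lambda>e. E x e i) (\<lambda>e. contract (\<lambda>f. E x f j) (\<lambda>f. d\<gamma> x f e c d))"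
  proof -
    have "contract (\<lambda>e. E x e i) (\<lambda>e. contract (\<lambda>f. E x f j) (\<lambda>f. d\<gamma> x e f c d)) = 
       (\<Sum>e\<in>UNIV. E x e j * (\<Sum>f\<in>UNIV. E x f i * d\<gamma> x f e c d))"
      by (subst contract_swap) (simp add: contract_def)
    then show ?thesis
      by (simp add: dA_def contract_def sum.distrib left_diff_distrib sum_subtractf)
  qed
  have 2: "(\<Sum>h\<in>UNIV. A x i c h * A x j h d) = contract (\<lambda>e. E x e i) (\<lambda>e. contract (\<lambda>f. E x f j) (\<lambda>f. \<Sum>h\<in>UNIV. \<gamma> x e c h * \<gamma> x f h d))" for i j
    by (simp add: contract_linear) (simp add: A_def contract_def)
  have 3: "(\<Sum>h\<in>UNIV. (dE x i h j - dE x j h i) * \<gamma> x h c d) =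
     - contract (\<lambda>e. E x e i) (\<lambda>e. contract (\<lambda>f. E x f j) (\<lambda>f. \<Sum>h\<in>UNIV. (\<gamma> x e h f - \<gamma> x f h e) * \<gamma> x h c d))"
    by (simp add: contract_sum contract_scale' torsion_free[OF x] sum_negf)
       (simp add: contract_def sum_distrib_left mult_ac)
  have 4: "contract (\<lambda>e. E x e j) (\<lambda>e. contract (\<lambda>f. E x f i) (\<lambda>f. h e f)) = contract (\<lambda>e. E x e i) (\<lambda>e. contract (\<lambda>f. E x f j) (\<lambda>f. h f e))" for h
    by (rule contract_swap)
  show ?thesis unfolding \<Omega>_def 1 sum_subtractf 2 3 4[of "\<lambda>e f. \<Sum>h\<in>UNIV. \<gamma> x e c h * \<gamma> x f h d"] curv_def
    by (simp add: contract_add contract_diff sum_subtractf)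
qed

lemma riemann_up_eq:
  assumes x: "x \<in> U"
  shows "riemann_up g x l s i j = (\<Sum>a\<in>UNIV. F x l a * (\<Sum>d\<in>UNIV. \<Omega> x i j a d * E x d s))"
  using sum_F_sum_E[OF x, of l "\<lambda>l. riemann_up g x l s i j"] by (simp add: E_riemann_up[OF x])

lemma riemann_eq:
  assumes x: "x \<in> U"
  shows "riemann g x l s i j = pull (E x) (\<lambda>a b e f. G x a * curv x a b e f) l s i j"
proof -
  have "riemann g x l s i j = (\<Sum>a\<in>UNIV. E x a l * (G x a * (\<Sum>k\<in>UNIV. E x a k * riemann_up g x k s i j)))"
    by (simp add: riemann_def metric[OF x] sum_distrib_right)
       (subst sum.swap, simp add: sum_distrib_left mult_ac)
  also have "\<dots> = pull (E x) (\<lambda>a b e f. G x a * curv x a b e f) l s i j"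
    by (simp add: E_riemann_up[OF x] \<Omega>_eq[OF x] pull_def contract_scale) (simp add: contract_def mult_ac)
  finally show ?thesis .
qed

definition ric :: "real^4 \<Rightarrow> 4 \<Rightarrow> 4 \<Rightarrow> real" where
  "ric x b d = (\<Sum>a\<in>UNIV. curv x a b a d)"

lemma ricci_eq:
  assumes x: "x \<in> U"
  shows "ricci g x i j = contract (\<lambda>b. E x b i) (\<lambda>b. contract (\<lambda>d. E x d j) (\<lambda>d. ric x b d))"
proof -
  have "ricci g x i j = (\<Sum>a\<in>UNIV. \<Sum>l\<in>UNIV. F x l a * (\<Sum>d\<in>UNIV. \<Omega> x l j a d * E x d i))"
    unfolding ricci_def riemann_up_eq[OF x] by (rule sum.swap)
  also have "\<dots> = (\<Sum>a\<in>UNIV. contract (\<lambda>b. E x b i) (\<lambda>b. contract (\<lambda>d. E x d j) (\<lambda>d. curv x a b a d)))"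
  proof (rule sum.cong[OF refl])
    fix a
    have R: "contract (\<lambda>l. F x l a) (\<lambda>l. contract (\<lambda>e. E x e l) h) = h a" for h
    proof -
      have "contract (\<lambda>l. F x l a) (\<lambda>l. contract (\<lambda>e. E x e l) h) = (\<Sum>e\<in>UNIV. (\<Sum>l\<in>UNIV. E x e l * F x l a) * h e)"
        by (simp add: contract_def sum_distrib_left sum_distrib_right mult_ac) (rule sum.swap)
      then show ?thesis by (simp add: E_F[OF x])
    qed
    have "(\<Sum>l\<in>UNIV. F x l a * (\<Sum>d\<in>UNIV. \<Omega> x l j a d * E x d i)) =
       contract (\<lambda>l. F x l a) (\<lambda>l. contract (\<lambda>b. E x b i) (\<lambda>b. \<Omega> x l j a b))"
      by (simp add: contract_def mult_ac)
    also have "\<dots> = contract (\<lambda>b. E x b i) (\<lambda>b. contract (\<lambda>l. F x l a) (\<lambda>l. \<Omega> x l j a b))" by (rule contract_swap)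
    also have "\<dots> = contract (\<lambda>b. E x b i) (\<lambda>b. contract (\<lambda>d. E x d j) (\<lambda>d. curv x a b a d))"
      by (simp add: \<Omega>_eq[OF x] R)
    finally show "(\<Sum>l\<in>UNIV. F x l a * (\<Sum>d\<in>UNIV. \<Omega> x l j a d * E x d i)) =
       contract (\<lambda>b. E x b i) (\<lambda>b. contract (\<lambda>d. E x d j) (\<lambda>d. curv x a b a d))" .
  qed
  finally show ?thesis by (simp add: ric_def contract_sum)
qed

definition scal :: "real^4 \<Rightarrow> real" where
  "scal x = (\<Sum>a\<in>UNIV. ric x a a / G x a)"

lemma scalar_curv_eq:
  assumes x: "x \<in> U" shows "scalar_curv g x = scal x"
proof -
  have "scalar_curv g x = (\<Sum>i\<in>UNIV. \<Sum>j\<in>UNIV. inv_metric g x $ i $ j * (\<Sum>d\<in>UNIV. E x d j * contract (\<lambda>b. E x b i) (\<lambda>b. ric x b d)))"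
    unfolding scalar_curv_def ricci_eq[OF x] by (subst contract_swap) (simp add: contract_def)
  also have "\<dots> = (\<Sum>i\<in>UNIV. \<Sum>a\<in>UNIV. F x i a * (\<Sum>b\<in>UNIV. E x b i * ric x b a) / G x a)"
    by (simp add: raise_E[OF x] contract_def)
  also have "\<dots> = (\<Sum>a\<in>UNIV. (\<Sum>i\<in>UNIV. \<Sum>b\<in>UNIV. (E x b i * F x i a) * ric x b a) / G x a)"
    by (subst sum.swap) (simp add: sum_divide_distrib sum_distrib_left mult_ac)
  also have "\<dots> = (\<Sum>a\<in>UNIV. (\<Sum>b\<in>UNIV. (\<Sum>i\<in>UNIV. E x b i * F x i a) * ric x b a) / G x a)"
    by (subst sum.swap) (simp add: sum_distrib_right)
  finally show ?thesis by (simp add: E_F[OF x] scal_def)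
qed

text \<open>In every product of two tensors the factor with the index \<open>a\<close> stands first,
  the shape to which \<open>pull_13_24\<close> and \<open>pull_14_23\<close> apply.\<close>

definition weyl_frame :: "real^4 \<Rightarrow> 4 \<Rightarrow> 4 \<Rightarrow> 4 \<Rightarrow> 4 \<Rightarrow> real" where
  "weyl_frame x a b c d = (let h = \<lambda>a c. if a = c then G x a else 0 in
     G x a * curv x a b c d
     - 1/2 * (h a c * ric x b d - h a d * ric x b c - ric x a d * h b c + ric x a c * h b d)
     + 1/6 * scal x * (h a c * h b d - h a d * h b c))"

lemma weyl_eq:
  assumes x: "x \<in> U"
  shows "weyl g x i j k l = pull (E x) (weyl_frame x) i j k l"
proof -
  define h where "h = (\<lambda>a c. if a = c then G x a else 0)"
  have g: "g x $ i $ j = contract (\<lambda>a. E x a i) (\<lambda>a. contract (\<lambda>c. E x c j) (h a))" for i j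
    by (simp add: metric[OF x] contract_def h_def if_distrib[of "\<lambda>z. _ * z"] mult_ac cong: if_cong)
  have W: "weyl_frame x = (\<lambda>a b c d. G x a * curv x a b c d
     - 1/2 * (h a c * ric x b d - h a d * ric x b c - ric x a d * h b c + ric x a c * h b d)
     + 1/6 * scal x * (h a c * h b d - h a d * h b c))"
    by (simp add: weyl_frame_def Let_def h_def fun_eq_iff)
  have "pull (E x) (weyl_frame x) i j k l = pull (E x) (\<lambda>a b c d. G x a * curv x a b c d) i j k l
    - 1/2 * (pull (E x) (\<lambda>a b c d. h a c * ric x b d) i j k l - pull (E x) (\<lambda>a b c d. h a d * ric x b c) i j k l
       - pull (E x) (\<lambda>a b c d. ric x a d * h b c) i j k l + pull (E x) (\<lambda>a b c d. ric x a c * h b d) i j k l)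
    + 1/6 * scal x * (pull (E x) (\<lambda>a b c d. h a c * h b d) i j k l - pull (E x) (\<lambda>a b c d. h a d * h b c) i j k l)"
    unfolding pull_def W by (simp only: contract_add contract_diff contract_scale[of _ "1/2"] contract_scale[of _ "1/6 * scal x"])
  then show ?thesis
    unfolding pull_13_24 pull_14_23 weyl_def riemann_eq[OF x] scalar_curv_eq[OF x] g ricci_eq[OF x]
    by (simp add: mult_ac)
qed

text \<open>The Leibniz rule for one index: by \<open>E_Gam\<close> the derivative of
  \<open>E\<close> splits into a Christoffel term on the coordinate index and a connection term on
  the frame index. Applied once per index in \<open>cov_deriv_eq\<close>, it produces exactly the
  Christoffel terms that \<open>cov_deriv\<close> subtracts.\<close>

lemma has_partial_pull_step:
  assumes x: "x \<in> U" and h: "\<And>a. has_partial (\<lambda>y. h y a) (h' a) u x"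
  shows "has_partial (\<lambda>y. contract (\<lambda>a. E y a i) (\<lambda>a. h y a))
    (contract (\<lambda>a. E x a i) (\<lambda>a. h' a - (\<Sum>c\<in>UNIV. A x u c a * h x c)) + 
      (\<Sum>s\<in>UNIV. Gam x s u i * contract (\<lambda>a. E x a s) (\<lambda>a. h x a))) u x"
proof -
  have "has_partial (\<lambda>y. contract (\<lambda>a. E y a i) (h y)) (\<Sum>a\<in>UNIV. dE x u a i * h x a + E x a i * h' a) u x"
    unfolding contract_def by (intro partial_intros dE x h)
  moreover have "(\<Sum>s\<in>UNIV. Gam x s u i * contract (\<lambda>a. E x a s) (\<lambda>a. h x a)) = (\<Sum>a\<in>UNIV. (\<Sum>s\<in>UNIV. E x a s * Gam x s u i) * h x a)"
    by (simp add: contract_def sum_distrib_left sum_distrib_right mult_ac) (rule sum.swap)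
  moreover have "contract (\<lambda>a. E x a i) (\<lambda>a. \<Sum>c\<in>UNIV. A x u c a * h x c) = (\<Sum>a\<in>UNIV. (\<Sum>d\<in>UNIV. A x u a d * E x d i) * h x a)"
    by (simp add: contract_def sum_distrib_left sum_distrib_right mult_ac) (rule sum.swap)
  ultimately show ?thesis
    by (elim has_partial_eq_rhs) (simp add: E_Gam[OF x] contract_diff sum.distrib distrib_right, simp add: contract_def)
qed

definition cov_frame :: "real^4 \<Rightarrow> (4 \<Rightarrow> 4 \<Rightarrow> 4 \<Rightarrow> 4 \<Rightarrow> real) \<Rightarrow> (4 \<Rightarrow> 4 \<Rightarrow> 4 \<Rightarrow> 4 \<Rightarrow> 4 \<Rightarrow> real) \<Rightarrow>
    4 \<Rightarrow> 4 \<Rightarrow> 4 \<Rightarrow> 4 \<Rightarrow> 4 \<Rightarrow> real" where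
  "cov_frame x t dt e a b c d = dt e a b c d
     - (\<Sum>h\<in>UNIV. \<gamma> x e h a * t h b c d + \<gamma> x e h b * t a h c d + \<gamma> x e h c * t a b h d + \<gamma> x e h d * t a b c h)"

lemma cov_deriv_eq:
  assumes x: "x \<in> U"
    and T: "\<And>y i j k l. y \<in> U \<Longrightarrow> T y i j k l = pull (E y) (t y) i j k l"
    and dt: "\<And>a b c d. has_partial (\<lambda>y. t y a b c d) (\<Sum>e\<in>UNIV. E x e u * dt e a b c d) u x"
  shows "cov_deriv g T x u i j k l = contract (\<lambda>e. E x e u) (\<lambda>e. pull (E x) (cov_frame x (t x) dt e) i j k l)"
proof -
  note step = has_partial_pull_step[OF x]
  have "has_partial (\<lambda>y. T y i j k l) D u x \<longleftrightarrow> has_partial (\<lambda>y. pull (E y) (t y) i j k l) D u x" for D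
    by (rule has_partial_cong[OF open_U x T])
  note D = this[THEN iffD2, THEN partial_deriv_eq, unfolded pull_def, OF step, OF step, OF step, OF step, OF dt]
  have dt': "(\<Sum>e\<in>UNIV. E x e u * dt e a b c d) = contract (\<lambda>e. E x e u) (\<lambda>e. dt e a b c d)" for a b c d
    by (simp add: contract_def)
  have A': "contract (\<lambda>e. E x e u) (\<lambda>e. \<gamma> x e c d) = A x u c d" for c d by (simp add: contract_def A_def)
  have "contract (\<lambda>e. E x e u) (\<lambda>e. pull (E x) (cov_frame x (t x) dt e) i j k l) =
    pull (E x) (\<lambda>a b c d. contract (\<lambda>e. E x e u) (\<lambda>e. cov_frame x (t x) dt e a b c d)) i j k l"
    unfolding pull_def by (simp only: contract_swap[of "\<lambda>e. E x e u"])
  also have "(\<lambda>a b c d. contract (\<lambda>e. E x e u) (\<lambda>e. cov_frame x (t x) dt e a b c d)) =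
    (\<lambda>a b c d. contract (\<lambda>e. E x e u) (\<lambda>e. dt e a b c d)
     - (\<Sum>h\<in>UNIV. A x u h a * t x h b c d + A x u h b * t x a h c d + A x u h c * t x a b h d + A x u h d * t x a b c h))"
    by (simp add: cov_frame_def contract_linear A')
  finally show ?thesis
    unfolding cov_deriv_def D christoffel_eq[OF x] T[OF x] dt'
    unfolding pull_def
    by (simp add: contract_linear sum.distrib algebra_simps)
qed

end

section \<open>Orientation, duality and the full contraction in frame components\<close>

lemma contract_divide: "contract v (\<lambda>a. f a / c) = contract v f / c"
  by (simp add: contract_def sum_divide_distrib)

lemma vector_4 [simp]:
  "(vector [a,b,c,d] :: 'a::zero^4) $ 1 = a" "(vector [a,b,c,d] :: 'a^4) $ 2 = b"
  "(vector [a,b,c,d] :: 'a^4) $ 3 = c" "(vector [a,b,c,d] :: 'a^4) $ 4 = d"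
  by (simp_all add: vector_def)

lemma det_4:
  "det (A::'a::comm_ring_1^4^4) =
    (A$1$1 * A$2$2 - A$1$2 * A$2$1) * (A$3$3 * A$4$4 - A$3$4 * A$4$3)
  - (A$1$1 * A$2$3 - A$1$3 * A$2$1) * (A$3$2 * A$4$4 - A$3$4 * A$4$2)
  + (A$1$1 * A$2$4 - A$1$4 * A$2$1) * (A$3$2 * A$4$3 - A$3$3 * A$4$2)
  + (A$1$2 * A$2$3 - A$1$3 * A$2$2) * (A$3$1 * A$4$4 - A$3$4 * A$4$1)
  - (A$1$2 * A$2$4 - A$1$4 * A$2$2) * (A$3$1 * A$4$3 - A$3$3 * A$4$1)
  + (A$1$3 * A$2$4 - A$1$4 * A$2$3) * (A$3$1 * A$4$2 - A$3$2 * A$4$1)"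
proof -
  have f: "finite {2::4,3,4}" "1 \<notin> {2::4,3,4}" "finite {3::4,4}" "2 \<notin> {3::4,4}" "finite {4::4}" "3 \<notin> {4::4}"
    by auto
  show ?thesis
    unfolding det_def UNIV_4 sum_over_permutations_insert[OF f(1,2)]
      sum_over_permutations_insert[OF f(3,4)] sum_over_permutations_insert[OF f(5,6)] permutes_sing
    by (simp add: sign_swap_id permutation_swap_id permutation_compose sign_compose sign_id swap_id_eq algebra_simps)
qed

definition delta :: "4 \<Rightarrow> 4 \<Rightarrow> real" where
  "delta i a = (if a = i then 1 else 0)"

lemma sum_delta:
  "(\<Sum>h\<in>UNIV. f h * delta i h) = f i"
  "(\<Sum>h\<in>UNIV. f h * (delta i h * c)) = f i * c" "(\<Sum>h\<in>UNIV. f h * (c * delta i h)) = f i * c"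
  "(\<Sum>h\<in>UNIV. f h * (delta h i * c)) = f i * c" "(\<Sum>h\<in>UNIV. f h * (c * delta h i)) = f i * c"
  by (simp_all add: delta_def if_distrib[of "\<lambda>z. _ * z"] if_distrib[of "\<lambda>z. z * _"] cong: if_cong)

definition wedge :: "4 \<Rightarrow> 4 \<Rightarrow> 4 \<Rightarrow> 4 \<Rightarrow> real" where
  "wedge i j a b = delta i a * delta j b - delta j a * delta i b"

text \<open>The antisymmetric symbol as a Laplace expansion over complementary index pairs, so that
  duals can be computed bivector by bivector.\<close>

definition eps :: "4 \<Rightarrow> 4 \<Rightarrow> 4 \<Rightarrow> 4 \<Rightarrow> real" where
  "eps a b c d = wedge 1 2 a b * wedge 3 4 c d - wedge 1 3 a b * wedge 2 4 c d + wedge 1 4 a b * wedge 2 3 c d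
     + wedge 2 3 a b * wedge 1 4 c d - wedge 2 4 a b * wedge 1 3 c d + wedge 3 4 a b * wedge 1 2 c d"

lemma contract_wedge: "contract v (\<lambda>a. contract w (\<lambda>b. wedge i j a b)) = v i * w j - v j * w i"
proof -
  have "contract v (\<lambda>a. delta i a) = v i" for v i by (simp add: contract_def sum_delta)
  then show ?thesis by (simp only: wedge_def contract_diff contract_scale contract_scale')
qed

lemma contract_wedge_wedge:
  "contract u (\<lambda>a. contract v (\<lambda>b. contract w (\<lambda>c. contract z (\<lambda>d. wedge i j a b * wedge k l c d)))) =
    (u i * v j - v i * u j) * (w k * z l - z k * w l)"
  by (subst contract_scale, subst contract_scale, subst contract_scale', subst contract_scale', subst contract_wedge, subst contract_wedge)
     (simp add: mult.commute)

lemma contract_eps: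
  "contract u (\<lambda>a. contract v (\<lambda>b. contract w (\<lambda>c. contract z (\<lambda>d. eps a b c d)))) =
     (u 1 * v 2 - v 1 * u 2) * (w 3 * z 4 - z 3 * w 4)
   - (u 1 * v 3 - v 1 * u 3) * (w 2 * z 4 - z 2 * w 4)
   + (u 1 * v 4 - v 1 * u 4) * (w 2 * z 3 - z 2 * w 3)
   + (u 2 * v 3 - v 2 * u 3) * (w 1 * z 4 - z 1 * w 4)
   - (u 2 * v 4 - v 2 * u 4) * (w 1 * z 3 - z 1 * w 3)
   + (u 3 * v 4 - v 3 * u 4) * (w 1 * z 2 - z 1 * w 2)"
  unfolding eps_def contract_add contract_diff contract_wedge_wedge ..

lemma det_eps:
  "det (vector [u, v, w, z] :: real^4^4) =
    contract (($) u) (\<lambda>a. contract (($) v) (\<lambda>b. contract (($) w) (\<lambda>c. contract (($) z) (\<lambda>d. eps a b c d))))"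
  unfolding contract_eps det_4 vector_4 by (simp add: algebra_simps)

text \<open>These two conditions make \<open>det E\<close> equal to the volume factor, so that the
  Levi-Civita tensor has the constant frame components \<open>eps\<close>.\<close>

locale oriented_frame = moving_frame +
  assumes det_E: "y \<in> U \<Longrightarrow> det (\<chi> a i. E y a i) > 0"
    and prod_G: "y \<in> U \<Longrightarrow> G y 1 * G y 2 * G y 3 * G y 4 = -1"
begin

lemma sqrt_det_g:
  assumes x: "x \<in> U" shows "sqrt (- det (g x)) = det (\<chi> a i. E x a i)"
proof -
  let ?E = "(\<chi> a i. E x a i) :: real^4^4" and ?G = "(\<chi> a b. if a = b then G x a else 0) :: real^4^4"
  have "g x = transpose ?E ** (?G ** ?E)"
    by (simp add: vec_eq_iff matrix_matrix_mult_def transpose_def metric[OF x] mult_ac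
        if_distrib[of "\<lambda>z. z * _"] if_distrib[of "\<lambda>z. _ * z"] cong: if_cong)
  then have "det (g x) = det ?E * (det ?G * det ?E)" by (simp add: det_mul det_transpose)
  also have "det ?G = -1" by (simp add: det_4 prod_G[OF x] flip: mult.assoc)
  finally show ?thesis using det_E[OF x] by (simp add: real_sqrt_mult_self)
qed

text \<open>Multiplying the matrix of unit rows by the transposed frame selects columns of
  \<open>E\<close>; volume factor times symbol is thus a single determinant, which
  \<open>det_eps\<close> expands.\<close>

lemma levi_civita_eq:
  assumes x: "x \<in> U" shows "levi_civita g x i j k l = pull (E x) eps i j k l"
proof -
  let ?E = "(\<chi> a i. E x a i) :: real^4^4"
  let ?M = "vector [axis i 1, axis j 1, axis k 1, axis l 1] :: real^4^4"
  have "?M ** transpose ?E = vector [\<chi> a. E x a i, \<chi> a. E x a j, \<chi> a. E x a k, \<chi> a. E x a l]"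
    unfolding vec_eq_iff forall_4[where P="\<lambda>i. \<forall>j. _ i j"]
    by (simp add: matrix_matrix_mult_def transpose_def axis_def if_distrib[of "\<lambda>z. z * _"] cong: if_cong)
  then have M: "det ?E * det ?M = det (vector [\<chi> a. E x a i, \<chi> a. E x a j, \<chi> a. E x a k, \<chi> a. E x a l] :: real^4^4)"
    by (subst mult.commute, subst (2) det_transpose[symmetric], subst det_mul[symmetric]) (rule arg_cong)
  have "($) (\<chi> a. E x a i) = (\<lambda>a. E x a i)" for i by (simp add: fun_eq_iff)
  then show ?thesis
    unfolding levi_civita_def sqrt_det_g[OF x] M unfolding det_eps pull_def by simp
qed

lemma contract_inv_metric:
  assumes x: "x \<in> U"
  shows "contract (\<lambda>j. inv_metric g x $ i $ j) (\<lambda>j. contract (\<lambda>a. E x a j) h) = contract (F x i) (\<lambda>a. h a / G x a)"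
  using raise_E[OF x, of i h] by (simp add: contract_def)

lemma sum_contract_E_F:
  assumes x: "x \<in> U"
  shows "(\<Sum>i\<in>UNIV. contract (\<lambda>a. E x a i) p * contract (F x i) q) = (\<Sum>a\<in>UNIV. p a * q a)"
proof -
  have "(\<Sum>i\<in>UNIV. contract (\<lambda>a. E x a i) p * contract (F x i) q) = 
    (\<Sum>i\<in>UNIV. \<Sum>a\<in>UNIV. p a * (E x a i * contract (F x i) q))"
    by (simp add: contract_def sum_distrib_right mult_ac)
  also have "\<dots> = (\<Sum>a\<in>UNIV. p a * (\<Sum>i\<in>UNIV. E x a i * contract (F x i) q))"
    by (subst sum.swap) (simp add: sum_distrib_left)
  finally show ?thesis by (simp add: contract_def sum_E_sum_F[OF x])
qed

text \<open>\<open>r\<close> bundles the remaining summation indices, so that \<open>E\<close> and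
  \<open>F\<close> cancel in the outermost index of a nested sum without reordering it.\<close>

lemma sum_contract_E_F_family:
  fixes p :: "4 \<Rightarrow> 'r::finite \<Rightarrow> real"
  assumes x: "x \<in> U"
  shows "(\<Sum>i\<in>UNIV. \<Sum>r\<in>UNIV. contract (\<lambda>a. E x a i) (\<lambda>a. p a r) * contract (F x i) (\<lambda>a. q a r)) =
    (\<Sum>a\<in>UNIV. \<Sum>r\<in>UNIV. p a r * q a r)"
  by (subst sum.swap, simp add: sum_contract_E_F[OF x]) (rule sum.swap)

definition dual_frame :: "real^4 \<Rightarrow> (4 \<Rightarrow> 4 \<Rightarrow> 4 \<Rightarrow> 4 \<Rightarrow> real) \<Rightarrow> 4 \<Rightarrow> 4 \<Rightarrow> 4 \<Rightarrow> 4 \<Rightarrow> real" where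
  "dual_frame x t a b c d = 1/2 * (\<Sum>u\<in>UNIV. \<Sum>v\<in>UNIV. eps a b u v * (t u v c d / (G x u * G x v)))"

lemma dual_weyl_eq:
  assumes x: "x \<in> U"
  shows "dual_weyl g x i j k l = pull (E x) (dual_frame x (weyl_frame x)) i j k l"
proof -
  let ?gi = "\<lambda>i j. inv_metric g x $ i $ j" and ?E = "\<lambda>i a. E x a i"
  define w where "w = (\<lambda>u v. contract (?E k) (\<lambda>c. contract (?E l) (\<lambda>d. weyl_frame x u v c d)))"
  have W: "(\<Sum>u'\<in>UNIV. \<Sum>v'\<in>UNIV. ?gi u u' * ?gi v v' * weyl g x u' v' k l) = 
     contract (F x u) (\<lambda>a. contract (F x v) (\<lambda>b. w a b / (G x a * G x b)))" for u v
  proof -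
    have "(\<Sum>u'\<in>UNIV. \<Sum>v'\<in>UNIV. ?gi u u' * ?gi v v' * weyl g x u' v' k l) =
      contract (?gi u) (\<lambda>u'. contract (?gi v) (\<lambda>v'. contract (?E u') (\<lambda>a. contract (?E v') (w a))))"
      by (simp add: weyl_eq[OF x] pull_def w_def contract_def[of "?gi _"] sum_distrib_left mult_ac)
    also have "\<dots> = contract (?gi u) (\<lambda>u'. contract (?E u') (\<lambda>a. contract (?gi v) (\<lambda>v'. contract (?E v') (w a))))"
      by (simp add: contract_swap[of "?gi v"])
    also have "\<dots> = contract (F x u) (\<lambda>a. contract (F x v) (\<lambda>b. w a b / G x b) / G x a)"
      by (simp add: contract_inv_metric[OF x])
    also have "(\<lambda>a. contract (F x v) (\<lambda>b. w a b / G x b) / G x a) = (\<lambda>a. contract (F x v) (\<lambda>b. w a b / (G x a * G x b)))"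
      by (simp add: mult.commute flip: contract_divide)
    finally show ?thesis .
  qed
  have "dual_weyl g x i j k l = 1/2 * (\<Sum>u\<in>UNIV. \<Sum>v\<in>UNIV.
      contract (?E u) (\<lambda>c. contract (?E v) (\<lambda>d. contract (?E i) (\<lambda>a. contract (?E j) (\<lambda>b. eps a b c d)))) *
      contract (F x u) (\<lambda>a. contract (F x v) (\<lambda>b. w a b / (G x a * G x b))))"
  proof -
    \<comment> \<open>The summed indices \<open>u\<close> and \<open>v\<close> move outermost, where
      \<open>E\<close> meets the \<open>F\<close> that came from raising the indices of the Weyl
      tensor.\<close>
    have "levi_civita g x i j u v = contract (?E u) (\<lambda>c. contract (?E v) (\<lambda>d. contract (?E i) (\<lambda>a. contract (?E j) (\<lambda>b. eps a b c d))))" for u v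
      unfolding levi_civita_eq[OF x] pull_def contract_swap[of "?E j" "?E u"] contract_swap[of "?E j" "?E v"]
        contract_swap[of "?E i" "?E u"] contract_swap[of "?E i" "?E v"] ..
    then show ?thesis by (simp add: dual_weyl_def W)
  qed
  also have "\<dots> = 1/2 * (\<Sum>c\<in>UNIV. \<Sum>d\<in>UNIV. contract (?E i) (\<lambda>a. contract (?E j) (\<lambda>b. eps a b c d)) * (w c d / (G x c * G x d)))"
    unfolding sum_contract_E_F_family[OF x, where p = "\<lambda>c v. contract (?E v) (\<lambda>d. contract (?E i) (\<lambda>a. contract (?E j) (\<lambda>b. eps a b c d)))"]
      sum_contract_E_F[OF x] ..
  also have "\<dots> = pull (E x) (dual_frame x (weyl_frame x)) i j k l"
    unfolding pull_def dual_frame_def w_def contract_linear contract_divide ..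
  finally show ?thesis .
qed

lemma I4_eq:
  assumes x: "x \<in> U"
    and C: "\<And>u i j k l. cov_deriv g (weyl g) x u i j k l = contract (\<lambda>e. E x e u) (\<lambda>e. pull (E x) (C e) i j k l)"
    and D: "\<And>u i j k l. cov_deriv g (dual_weyl g) x u i j k l = contract (\<lambda>e. E x e u) (\<lambda>e. pull (E x) (D e) i j k l)"
  shows "I4 g x = (\<Sum>e\<in>UNIV. \<Sum>a\<in>UNIV. \<Sum>b\<in>UNIV. \<Sum>c\<in>UNIV. \<Sum>d\<in>UNIV.
    C e a b c d * (D e a b c d / (G x e * G x a * G x b * G x c * G x d)))"
proof -
  let ?E = "\<lambda>i a. E x a i"
  define gi where "gi i j = inv_metric g x $ i $ j" for i j
  have gi: "contract (gi i) (\<lambda>j. contract (\<lambda>a. E x a j) h) = contract (F x i) (\<lambda>a. h a / G x a)" for i h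
    using contract_inv_metric[OF x, of i h] by (simp add: gi_def[abs_def])
  have sw: "contract (gi i) (\<lambda>j. contract (?E k) (\<lambda>e. f j e)) = contract (?E k) (\<lambda>e. contract (gi i) (\<lambda>j. f j e))" for i k f
    by (rule contract_swap)
  define Q where "Q u i j k l = contract (F x u) (\<lambda>e. contract (F x i) (\<lambda>a. contract (F x j) (\<lambda>b. contract (F x k) (\<lambda>c. contract (F x l) (\<lambda>d.
     D e a b c d / (G x e * G x a * G x b * G x c * G x d))))))" for u i j k l
  have "(\<Sum>u'\<in>UNIV. \<Sum>i'\<in>UNIV. \<Sum>j'\<in>UNIV. \<Sum>k'\<in>UNIV. \<Sum>l'\<in>UNIV.
        inv_metric g x $ u $ u' * inv_metric g x $ i $ i' * inv_metric g x $ j $ j' *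
        inv_metric g x $ k $ k' * inv_metric g x $ l $ l' *
        cov_deriv g (dual_weyl g) x u' i' j' k' l') = Q u i j k l" for u i j k l
  proof -
    have "(\<Sum>u'\<in>UNIV. \<Sum>i'\<in>UNIV. \<Sum>j'\<in>UNIV. \<Sum>k'\<in>UNIV. \<Sum>l'\<in>UNIV.
        inv_metric g x $ u $ u' * inv_metric g x $ i $ i' * inv_metric g x $ j $ j' *
        inv_metric g x $ k $ k' * inv_metric g x $ l $ l' *
        cov_deriv g (dual_weyl g) x u' i' j' k' l') =
      contract (gi u) (\<lambda>u'. contract (gi i) (\<lambda>i'. contract (gi j) (\<lambda>j'. contract (gi k) (\<lambda>k'. contract (gi l) (\<lambda>l'.
        contract (?E u') (\<lambda>e. contract (?E i') (\<lambda>a. contract (?E j') (\<lambda>b. contract (?E k') (\<lambda>c. contract (?E l') (\<lambda>d. D e a b c d))))))))))"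
      unfolding D pull_def
      by (simp only: contract_def[of "gi _"] sum_distrib_left mult.assoc flip: gi_def)
    also have "\<dots> = contract (F x u) (\<lambda>e. contract (F x i) (\<lambda>a. contract (F x j) (\<lambda>b. contract (F x k) (\<lambda>c. contract (F x l) (\<lambda>d.
     D e a b c d / G x d) / G x c) / G x b) / G x a) / G x e)"
      by (simp only: sw gi)
    also have "\<dots> = Q u i j k l"
      by (simp only: Q_def divide_divide_eq_left mult_ac flip: contract_divide)
    finally show ?thesis .
  qed
  then have "I4 g x = (\<Sum>u\<in>UNIV. \<Sum>i\<in>UNIV. \<Sum>j\<in>UNIV. \<Sum>k\<in>UNIV. \<Sum>l\<in>UNIV.
     contract (?E u) (\<lambda>e. contract (?E i) (\<lambda>a. contract (?E j) (\<lambda>b. contract (?E k) (\<lambda>c. contract (?E l) (\<lambda>d. C e a b c d))))) * Q u i j k l)"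
    by (simp only: I4_def C pull_def)
  note I4 = this
  have pair: "(\<Sum>r\<in>UNIV. f r) = (\<Sum>a\<in>UNIV. \<Sum>b\<in>UNIV. f (a, b))" for f :: "'r::finite \<times> 's::finite \<Rightarrow> real"
    by (simp add: sum.cartesian_product flip: UNIV_Times_UNIV)
  note fam = sum_contract_E_F_family[OF x]
  have 1: "(\<Sum>u\<in>UNIV. \<Sum>i\<in>UNIV. \<Sum>j\<in>UNIV. \<Sum>k\<in>UNIV. \<Sum>l\<in>UNIV. contract (?E u) (\<lambda>e. p e i j k l) * contract (F x u) (\<lambda>e. q e i j k l))
     = (\<Sum>e\<in>UNIV. \<Sum>i\<in>UNIV. \<Sum>j\<in>UNIV. \<Sum>k\<in>UNIV. \<Sum>l\<in>UNIV. p e i j k l * q e i j k l)" for p q :: "4 \<Rightarrow> 4 \<Rightarrow> 4 \<Rightarrow> 4 \<Rightarrow> 4 \<Rightarrow> real"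
    using fam[of "\<lambda>e (i,j,k,l). p e i j k l" "\<lambda>e (i,j,k,l). q e i j k l"] by (simp only: pair prod.case)
  have 2: "(\<Sum>u\<in>UNIV. \<Sum>i\<in>UNIV. \<Sum>j\<in>UNIV. \<Sum>k\<in>UNIV. contract (?E u) (\<lambda>e. p e i j k) * contract (F x u) (\<lambda>e. q e i j k))
     = (\<Sum>e\<in>UNIV. \<Sum>i\<in>UNIV. \<Sum>j\<in>UNIV. \<Sum>k\<in>UNIV. p e i j k * q e i j k)" for p q :: "4 \<Rightarrow> 4 \<Rightarrow> 4 \<Rightarrow> 4 \<Rightarrow> real"
    using fam[of "\<lambda>e (i,j,k). p e i j k" "\<lambda>e (i,j,k). q e i j k"] by (simp only: pair prod.case)
  have 3: "(\<Sum>u\<in>UNIV. \<Sum>i\<in>UNIV. \<Sum>j\<in>UNIV. contract (?E u) (\<lambda>e. p e i j) * contract (F x u) (\<lambda>e. q e i j))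
     = (\<Sum>e\<in>UNIV. \<Sum>i\<in>UNIV. \<Sum>j\<in>UNIV. p e i j * q e i j)" for p q :: "4 \<Rightarrow> 4 \<Rightarrow> 4 \<Rightarrow> real"
    using fam[of "\<lambda>e (i,j). p e i j" "\<lambda>e (i,j). q e i j"] by (simp only: pair prod.case)
  show ?thesis
    unfolding I4 Q_def by (simp only: 1 2 3 fam sum_contract_E_F[OF x])
qed

end

section \<open>Weyl tensors of type D\<close>

text \<open>
  The combination $P\,(\ldots)+N\,(\ldots)$ above, expanded in products of the six basis bivectors for a
  frame metric with \<open>G 1 * G 2 = -1\<close> and \<open>G 3 * G 4 = 1\<close>.
\<close>

definition typeD :: "(4 \<Rightarrow> real) \<Rightarrow> real \<Rightarrow> real \<Rightarrow> 4 \<Rightarrow> 4 \<Rightarrow> 4 \<Rightarrow> 4 \<Rightarrow> real" where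
  "typeD G P N a b c d =
     P * (2 * wedge 1 2 a b * wedge 1 2 c d - 2 * wedge 3 4 a b * wedge 3 4 c d
       + G 1 * G 3 * wedge 1 3 a b * wedge 1 3 c d + G 1 * G 4 * wedge 1 4 a b * wedge 1 4 c d
       + G 2 * G 3 * wedge 2 3 a b * wedge 2 3 c d + G 2 * G 4 * wedge 2 4 a b * wedge 2 4 c d)
   + N * (- 2 * wedge 1 2 a b * wedge 3 4 c d - 2 * wedge 3 4 a b * wedge 1 2 c d
       - wedge 1 3 a b * wedge 2 4 c d - wedge 2 4 a b * wedge 1 3 c d
       + wedge 1 4 a b * wedge 2 3 c d + wedge 2 3 a b * wedge 1 4 c d)"

lemma wedge_same: "wedge i i a b = 0" "wedge i j a a = 0"
  by (simp_all add: wedge_def)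

lemma wedge_flip: "wedge j i a b = - wedge i j a b" "wedge i j b a = - wedge i j a b"
  unfolding wedge_def by (simp_all only: minus_diff_eq mult.commute)

lemma wedge_table:
  "wedge 1 2 3 4 = 0" "wedge 1 2 2 4 = 0" "wedge 1 2 2 3 = 0" "wedge 1 2 1 4 = 0" "wedge 1 2 1 3 = 0" "wedge 1 2 1 2 = 1"
  "wedge 1 3 3 4 = 0" "wedge 1 3 2 4 = 0" "wedge 1 3 2 3 = 0" "wedge 1 3 1 4 = 0" "wedge 1 3 1 3 = 1" "wedge 1 3 1 2 = 0"
  "wedge 1 4 3 4 = 0" "wedge 1 4 2 4 = 0" "wedge 1 4 2 3 = 0" "wedge 1 4 1 4 = 1" "wedge 1 4 1 3 = 0" "wedge 1 4 1 2 = 0"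
  "wedge 2 3 3 4 = 0" "wedge 2 3 2 4 = 0" "wedge 2 3 2 3 = 1" "wedge 2 3 1 4 = 0" "wedge 2 3 1 3 = 0" "wedge 2 3 1 2 = 0"
  "wedge 2 4 3 4 = 0" "wedge 2 4 2 4 = 1" "wedge 2 4 2 3 = 0" "wedge 2 4 1 4 = 0" "wedge 2 4 1 3 = 0" "wedge 2 4 1 2 = 0"
  "wedge 3 4 3 4 = 1" "wedge 3 4 2 4 = 0" "wedge 3 4 2 3 = 0" "wedge 3 4 1 4 = 0" "wedge 3 4 1 3 = 0" "wedge 3 4 1 2 = 0"
  by (simp_all add: wedge_def delta_def)

lemma sum_sum_wedge: "(\<Sum>u\<in>UNIV. \<Sum>v\<in>UNIV. wedge i j u v * t u v) = t i j - t j i"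
proof -
  have "wedge i j u v * t u v = t u v * (delta i u * delta j v) - t u v * (delta j u * delta i v)" for u v
    by (simp add: wedge_def algebra_simps)
  then have "(\<Sum>u\<in>UNIV. \<Sum>v\<in>UNIV. wedge i j u v * t u v) =
      (\<Sum>u\<in>UNIV. t u j * delta i u) - (\<Sum>u\<in>UNIV. t u i * delta j u)"
    by (simp only: sum_subtractf sum_delta)
  then show ?thesis by (simp only: sum_delta)
qed

lemma sum_antisym:
  fixes f :: "4 \<Rightarrow> 4 \<Rightarrow> real"
  assumes "\<And>a b. f b a = f a b" "\<And>a. f a a = 0"
  shows "(\<Sum>a\<in>UNIV. \<Sum>b\<in>UNIV. f a b) = 2 * (f 1 2 + f 1 3 + f 1 4 + f 2 3 + f 2 4 + f 3 4)"
  by (simp add: sum_4 assms(2) assms(1)[of 1] assms(1)[of 2 3] assms(1)[of 2 4] assms(1)[of 3 4])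

lemma wedge_derivation:
  fixes \<gamma> :: "4 \<Rightarrow> 4 \<Rightarrow> real"
  shows "(\<Sum>h\<in>UNIV. \<gamma> h a * wedge i j h b + \<gamma> h b * wedge i j a h) = (\<Sum>h\<in>UNIV. \<gamma> i h * wedge h j a b + \<gamma> j h * wedge i h a b)"
  by (simp only: wedge_def right_diff_distrib sum.distrib sum_subtractf sum_delta)

definition nabla_wedge_12 :: "(4 \<Rightarrow> 4 \<Rightarrow> real) \<Rightarrow> 4 \<Rightarrow> 4 \<Rightarrow> real" where
  "nabla_wedge_12 \<gamma> a b = - \<gamma> 2 3 * wedge 1 3 a b - \<gamma> 2 4 * wedge 1 4 a b + \<gamma> 1 3 * wedge 2 3 a b + \<gamma> 1 4 * wedge 2 4 a b"

definition nabla_wedge_34 :: "(4 \<Rightarrow> 4 \<Rightarrow> real) \<Rightarrow> 4 \<Rightarrow> 4 \<Rightarrow> real" where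
  "nabla_wedge_34 \<gamma> a b = \<gamma> 4 1 * wedge 1 3 a b - \<gamma> 3 1 * wedge 1 4 a b + \<gamma> 4 2 * wedge 2 3 a b - \<gamma> 3 2 * wedge 2 4 a b"

definition nabla_typeD :: "(4 \<Rightarrow> real) \<Rightarrow> (4 \<Rightarrow> 4 \<Rightarrow> real) \<Rightarrow> real \<Rightarrow> real \<Rightarrow> real \<Rightarrow> real \<Rightarrow> 4 \<Rightarrow> 4 \<Rightarrow> 4 \<Rightarrow> 4 \<Rightarrow> real" where
  "nabla_typeD G \<gamma> P N P' N' a b c d = typeD G P' N' a b c d
     + 3 * P * (nabla_wedge_12 \<gamma> a b * wedge 1 2 c d + wedge 1 2 a b * nabla_wedge_12 \<gamma> c d - nabla_wedge_34 \<gamma> a b * wedge 3 4 c d - wedge 3 4 a b * nabla_wedge_34 \<gamma> c d)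
     - 3 * N * (nabla_wedge_12 \<gamma> a b * wedge 3 4 c d + wedge 3 4 a b * nabla_wedge_12 \<gamma> c d + nabla_wedge_34 \<gamma> a b * wedge 1 2 c d + wedge 1 2 a b * nabla_wedge_34 \<gamma> c d)"

definition partial_typeD :: "(4 \<Rightarrow> real) \<Rightarrow> (4 \<Rightarrow> real) \<Rightarrow> real \<Rightarrow> real \<Rightarrow> real \<Rightarrow> real \<Rightarrow> 4 \<Rightarrow> 4 \<Rightarrow> 4 \<Rightarrow> 4 \<Rightarrow> real" where
  "partial_typeD G G' P N P' N' a b c d = typeD G P' N' a b c d +
     P * ((G' 1 * G 3 + G 1 * G' 3) * wedge 1 3 a b * wedge 1 3 c d + (G' 1 * G 4 + G 1 * G' 4) * wedge 1 4 a b * wedge 1 4 c d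
       + (G' 2 * G 3 + G 2 * G' 3) * wedge 2 3 a b * wedge 2 3 c d + (G' 2 * G 4 + G 2 * G' 4) * wedge 2 4 a b * wedge 2 4 c d)"

locale adapted =
  fixes G :: "4 \<Rightarrow> real" and G' :: "4 \<Rightarrow> real" and \<gamma> :: "4 \<Rightarrow> 4 \<Rightarrow> real"
  assumes G12: "G 1 * G 2 = -1" and G34: "G 3 * G 4 = 1"
    and \<gamma>12: "\<gamma> 1 1 + \<gamma> 2 2 = 0" and \<gamma>34: "\<gamma> 3 3 + \<gamma> 4 4 = 0"
    and comp: "\<And>c d. (if c = d then G' c else 0) = G c * \<gamma> c d + G d * \<gamma> d c"
begin

lemma compatible_simps:
  "G 2 = - 1 / G 1" "G 4 = 1 / G 3" "G 1 \<noteq> 0" "G 3 \<noteq> 0"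
  "\<gamma> 2 2 = - \<gamma> 1 1" "\<gamma> 4 4 = - \<gamma> 3 3" "\<gamma> 2 1 = G 1 ^ 2 * \<gamma> 1 2" "\<gamma> 4 3 = - (G 3 ^ 2) * \<gamma> 3 4"
  "\<gamma> 3 1 = - G 1 / G 3 * \<gamma> 1 3" "\<gamma> 4 1 = - G 1 * G 3 * \<gamma> 1 4"
  "\<gamma> 3 2 = \<gamma> 2 3 / (G 1 * G 3)" "\<gamma> 4 2 = G 3 / G 1 * \<gamma> 2 4"
  "G' 1 = 2 * G 1 * \<gamma> 1 1" "G' 3 = 2 * G 3 * \<gamma> 3 3" "G' 2 = 2 * \<gamma> 1 1 / G 1" "G' 4 = - 2 * \<gamma> 3 3 / G 3"
proof -
  show g: "G 1 \<noteq> 0" "G 3 \<noteq> 0" using G12 G34 by auto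
  show s: "G 2 = - 1 / G 1" "G 4 = 1 / G 3" using G12 G34 g by (simp_all add: field_simps)
  show t: "\<gamma> 2 2 = - \<gamma> 1 1" "\<gamma> 4 4 = - \<gamma> 3 3" using \<gamma>12 \<gamma>34 by simp_all
  show "\<gamma> 2 1 = G 1 ^ 2 * \<gamma> 1 2" using comp[of 1 2] g by (simp add: s field_simps power2_eq_square)
  show "\<gamma> 4 3 = - (G 3 ^ 2) * \<gamma> 3 4" using comp[of 3 4] g by (simp add: s field_simps power2_eq_square)
  show "\<gamma> 3 1 = - G 1 / G 3 * \<gamma> 1 3" using comp[of 1 3] g by (simp add: s field_simps)
  show "\<gamma> 4 1 = - G 1 * G 3 * \<gamma> 1 4" using comp[of 1 4] g by (simp add: s field_simps)
  show "\<gamma> 3 2 = \<gamma> 2 3 / (G 1 * G 3)" using comp[of 2 3] g by (simp add: s field_simps)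
  show "\<gamma> 4 2 = G 3 / G 1 * \<gamma> 2 4" using comp[of 2 4] g by (simp add: s field_simps)
  show "G' 1 = 2 * G 1 * \<gamma> 1 1" "G' 3 = 2 * G 3 * \<gamma> 3 3" "G' 2 = 2 * \<gamma> 1 1 / G 1" "G' 4 = - 2 * \<gamma> 3 3 / G 3"
    using comp[of 1 1] comp[of 2 2] comp[of 3 3] comp[of 4 4] g by (simp_all add: s t)
qed

lemma compatible_simps_inverse:
  assumes "ga = G 1" "gb = G 3" "gai = inverse ga" "gbi = inverse gb"
  shows "G 1 = ga" "G 2 = - gai" "G 3 = gb" "G 4 = gbi"
  "\<gamma> 2 2 = - \<gamma> 1 1" "\<gamma> 4 4 = - \<gamma> 3 3" "\<gamma> 2 1 = ga * (ga * \<gamma> 1 2)" "\<gamma> 4 3 = - (gb * (gb * \<gamma> 3 4))"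
  "\<gamma> 3 1 = - (ga * (gbi * \<gamma> 1 3))" "\<gamma> 4 1 = - (ga * (gb * \<gamma> 1 4))"
  "\<gamma> 3 2 = gai * (gbi * \<gamma> 2 3)" "\<gamma> 4 2 = gai * (gb * \<gamma> 2 4)"
  "G' 1 = 2 * (ga * \<gamma> 1 1)" "G' 3 = 2 * (gb * \<gamma> 3 3)" "G' 2 = 2 * (gai * \<gamma> 1 1)" "G' 4 = - (2 * (gbi * \<gamma> 3 3))"
  and "inverse ga = gai" "inverse gb = gbi" "inverse gai = ga" "inverse gbi = gb" "ga * gai = 1" "gb * gbi = 1" "ga * (gai * z) = z" "gb * (gbi * z) = z" "gai * ga = 1" "gbi * gb = 1" "gai * (ga * z) = z" "gbi * (gb * z) = z"
proof -
  show "inverse ga = gai" "inverse gb = gbi" "inverse gai = ga" "inverse gbi = gb" using assms by simp_all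
  have nz: "ga \<noteq> 0" "gb \<noteq> 0" using assms compatible_simps by simp_all
  show c: "ga * gai = 1" "gb * gbi = 1" "gai * ga = 1" "gbi * gb = 1" using nz assms(3,4) by simp_all
  show "ga * (gai * z) = z" "gb * (gbi * z) = z" "gai * (ga * z) = z" "gbi * (gb * z) = z"
    using c by (simp_all flip: mult.assoc)
qed (simp_all add: assms compatible_simps divide_inverse power2_eq_square)

lemma derivation_typeD:
  "partial_typeD G G' P N P' N' a b c d - (\<Sum>h\<in>UNIV. \<gamma> h a * typeD G P N h b c d + \<gamma> h b * typeD G P N a h c d
      + \<gamma> h c * typeD G P N a b h d + \<gamma> h d * typeD G P N a b c h) = nabla_typeD G \<gamma> P N P' N' a b c d"
proof -
  define ga gb gai gbi where "ga = G 1" "gb = G 3" "gai = inverse ga" "gbi = inverse gb"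
  note s = compatible_simps_inverse[OF this]
  define X where "X i j = wedge i j a b" for i j
  define Y where "Y i j = wedge i j c d" for i j
  have D: "(\<Sum>h\<in>UNIV. \<gamma> h a * (wedge i j h b * wedge k l c d) + \<gamma> h b * (wedge i j a h * wedge k l c d)
      + \<gamma> h c * (wedge i j a b * wedge k l h d) + \<gamma> h d * (wedge i j a b * wedge k l c h))
    = (\<Sum>h\<in>UNIV. \<gamma> i h * X h j + \<gamma> j h * X i h) * Y k l + X i j * (\<Sum>h\<in>UNIV. \<gamma> k h * Y h l + \<gamma> l h * Y k h)" for i j k l
  proof -
    have "(\<Sum>h\<in>UNIV. \<gamma> h a * (wedge i j h b * wedge k l c d) + \<gamma> h b * (wedge i j a h * wedge k l c d)
      + \<gamma> h c * (wedge i j a b * wedge k l h d) + \<gamma> h d * (wedge i j a b * wedge k l c h))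
      = (\<Sum>h\<in>UNIV. \<gamma> h a * wedge i j h b + \<gamma> h b * wedge i j a h) * Y k l + X i j * (\<Sum>h\<in>UNIV. \<gamma> h c * wedge k l h d + \<gamma> h d * wedge k l c h)"
      by (simp add: X_def Y_def sum.distrib distrib_left distrib_right sum_distrib_left sum_distrib_right mult_ac)
    then show ?thesis by (simp add: wedge_derivation X_def Y_def)
  qed
  define DD where "DD i j k l = (\<Sum>h\<in>UNIV. \<gamma> i h * X h j + \<gamma> j h * X i h) * Y k l + X i j * (\<Sum>h\<in>UNIV. \<gamma> k h * Y h l + \<gamma> l h * Y k h)" for i j k l
  have XY: "X i i = 0" "Y i i = 0" "X 2 1 = - X 1 2" "X 3 1 = - X 1 3" "X 4 1 = - X 1 4" "X 3 2 = - X 2 3" "X 4 2 = - X 2 4" "X 4 3 = - X 3 4"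
    "Y 2 1 = - Y 1 2" "Y 3 1 = - Y 1 3" "Y 4 1 = - Y 1 4" "Y 3 2 = - Y 2 3" "Y 4 2 = - Y 2 4" "Y 4 3 = - Y 3 4" for i
    by (simp_all add: X_def Y_def wedge_same wedge_flip(1)[of 2 1] wedge_flip(1)[of 3 1] wedge_flip(1)[of 4 1]
      wedge_flip(1)[of 3 2] wedge_flip(1)[of 4 2] wedge_flip(1)[of 4 3])
  have "(\<Sum>h\<in>UNIV. \<gamma> h a * typeD G P N h b c d + \<gamma> h b * typeD G P N a h c d
      + \<gamma> h c * typeD G P N a b h d + \<gamma> h d * typeD G P N a b c h) =
    P * (2 * DD 1 2 1 2 - 2 * DD 3 4 3 4 + G 1 * G 3 * DD 1 3 1 3 + G 1 * G 4 * DD 1 4 1 4 + G 2 * G 3 * DD 2 3 2 3 + G 2 * G 4 * DD 2 4 2 4)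
   + N * (- 2 * DD 1 2 3 4 - 2 * DD 3 4 1 2 - DD 1 3 2 4 - DD 2 4 1 3 + DD 1 4 2 3 + DD 2 3 1 4)"
    unfolding DD_def D[symmetric] typeD_def
    by (simp add: sum_distrib_left algebra_simps sum.distrib sum_subtractf sum_negf)
  then show ?thesis
    unfolding partial_typeD_def nabla_typeD_def nabla_wedge_12_def nabla_wedge_34_def typeD_def DD_def
    unfolding X_def[symmetric] Y_def[symmetric]
    apply (simp only: sum_4 XY s)
    apply (simp add: algebra_simps s(21-))
    done
qed

lemma dual_typeD:
  "1/2 * (\<Sum>u\<in>UNIV. \<Sum>v\<in>UNIV. eps a b u v * (typeD G P N u v c d / (G u * G v))) = typeD G (- N) P a b c d"
proof -
  define ga gb gai gbi where "ga = G 1" "gb = G 3" "gai = inverse ga" "gbi = inverse gb"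
  note s = compatible_simps_inverse[OF this]
  let ?t = "\<lambda>u v. typeD G P N u v c d / (G u * G v)"
  have t: "?t v u = - ?t u v" for u v
    unfolding minus_divide_left mult.commute[of "G v"]
    by (rule arg_cong[where f="\<lambda>z. z / (G u * G v)"]) (simp add: typeD_def wedge_flip(2)[of _ _ v u] algebra_simps)
  have b: "(\<Sum>u\<in>UNIV. \<Sum>v\<in>UNIV. wedge i j u v * ?t u v) = 2 * ?t i j" for i j
    unfolding sum_sum_wedge using t[of i j] by simp
  have eps: "(\<Sum>u\<in>UNIV. \<Sum>v\<in>UNIV. eps a b u v * ?t u v) = 
      wedge 1 2 a b * (\<Sum>u\<in>UNIV. \<Sum>v\<in>UNIV. wedge 3 4 u v * ?t u v)
    - wedge 1 3 a b * (\<Sum>u\<in>UNIV. \<Sum>v\<in>UNIV. wedge 2 4 u v * ?t u v)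
    + wedge 1 4 a b * (\<Sum>u\<in>UNIV. \<Sum>v\<in>UNIV. wedge 2 3 u v * ?t u v)
    + wedge 2 3 a b * (\<Sum>u\<in>UNIV. \<Sum>v\<in>UNIV. wedge 1 4 u v * ?t u v)
    - wedge 2 4 a b * (\<Sum>u\<in>UNIV. \<Sum>v\<in>UNIV. wedge 1 3 u v * ?t u v)
    + wedge 3 4 a b * (\<Sum>u\<in>UNIV. \<Sum>v\<in>UNIV. wedge 1 2 u v * ?t u v)"
    by (simp only: eps_def distrib_right left_diff_distrib sum.distrib sum_subtractf sum_distrib_left mult.assoc)
  have "1/2 * (\<Sum>u\<in>UNIV. \<Sum>v\<in>UNIV. eps a b u v * ?t u v) =
     wedge 1 2 a b * ?t 3 4 - wedge 1 3 a b * ?t 2 4 + wedge 1 4 a b * ?t 2 3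
     + wedge 2 3 a b * ?t 1 4 - wedge 2 4 a b * ?t 1 3 + wedge 3 4 a b * ?t 1 2"
    unfolding eps b by (simp add: algebra_simps)
  also have "\<dots> = typeD G (- N) P a b c d"
  proof -
    show ?thesis
      unfolding typeD_def by (simp only: wedge_table s divide_inverse inverse_mult_distrib inverse_minus_eq)
         (simp add: algebra_simps s(21-))
  qed
  finally show ?thesis .
qed

lemma contraction_nabla_typeD:
  "(\<Sum>a\<in>UNIV. \<Sum>b\<in>UNIV. \<Sum>c\<in>UNIV. \<Sum>d\<in>UNIV.
      nabla_typeD G \<gamma> P N P' N' a b c d * (nabla_typeD G \<gamma> (- N) P (- N') P' a b c d / (H * G a * G b * G c * G d))) =
    (- 96 * P' * N' + 144 * ((P\<^sup>2 - N\<^sup>2) * (2 * (\<gamma> 1 4 * \<gamma> 2 3 - \<gamma> 1 3 * \<gamma> 2 4))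
       + 2 * P * N * ((\<gamma> 2 3)\<^sup>2 / (G 1 * G 3) + (\<gamma> 2 4)\<^sup>2 / (G 1 * G 4) + (\<gamma> 1 3)\<^sup>2 / (G 2 * G 3) + (\<gamma> 1 4)\<^sup>2 / (G 2 * G 4)))) / H"
proof -
  define ga gb gai gbi where "ga = G 1" "gb = G 3" "gai = inverse ga" "gbi = inverse gb"
  note s = compatible_simps_inverse[OF this]
  let ?f = "\<lambda>a b c d. nabla_typeD G \<gamma> P N P' N' a b c d * (nabla_typeD G \<gamma> (- N) P (- N') P' a b c d / (H * G a * G b * G c * G d))"
  have n: "nabla_wedge_12 \<gamma> b a = - nabla_wedge_12 \<gamma> a b" "nabla_wedge_34 \<gamma> b a = - nabla_wedge_34 \<gamma> a b" for a b
    unfolding nabla_wedge_12_def nabla_wedge_34_def wedge_flip(2)[of _ _ b a] by simp_all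
  have nt: "nabla_typeD G \<gamma> P N P' N' b a c d = - nabla_typeD G \<gamma> P N P' N' a b c d"
    "nabla_typeD G \<gamma> P N P' N' a b d c = - nabla_typeD G \<gamma> P N P' N' a b c d" for P N P' N' a b c d
    unfolding nabla_typeD_def typeD_def n(1)[of b a] n(2)[of b a] n(1)[of d c] n(2)[of d c] wedge_flip(2)[of _ _ b a] wedge_flip(2)[of _ _ d c]
    by (simp_all add: algebra_simps)
  have z: "nabla_typeD G \<gamma> P N P' N' a a c d = 0" "nabla_typeD G \<gamma> P N P' N' a b c c = 0" for P N P' N' a b c d
    using nt(1)[of P N P' N' a a c d] nt(2)[of P N P' N' a b c c] by simp_all
  have f: "?f b a c d = ?f a b c d" "?f a b d c = ?f a b c d" "?f a a c d = 0" "?f a b c c = 0" for a b c d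
    unfolding nt(1)[of _ _ _ _ b a] nt(2)[of _ _ _ _ _ _ d c] z by (simp_all add: mult_ac)
  have 1: "(\<Sum>c\<in>UNIV. \<Sum>d\<in>UNIV. ?f a b c d) = 2 * (?f a b 1 2 + ?f a b 1 3 + ?f a b 1 4 + ?f a b 2 3 + ?f a b 2 4 + ?f a b 3 4)" for a b
    by (rule sum_antisym) (fact f)+
  let ?h = "\<lambda>a b. 2 * (?f a b 1 2 + ?f a b 1 3 + ?f a b 1 4 + ?f a b 2 3 + ?f a b 2 4 + ?f a b 3 4)"
  have 2: "(\<Sum>a\<in>UNIV. \<Sum>b\<in>UNIV. ?h a b) = 2 * (?h 1 2 + ?h 1 3 + ?h 1 4 + ?h 2 3 + ?h 2 4 + ?h 3 4)"
    by (rule sum_antisym) (simp_all only: f mult_zero_right add_0_left add_0_right)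
  show ?thesis
    unfolding 1 2
    unfolding nabla_typeD_def typeD_def nabla_wedge_12_def nabla_wedge_34_def
    apply (simp only: wedge_table mult_zero_right mult_zero_left add_0_left add_0_right diff_0_right diff_0 mult_1_right mult_1_left minus_zero)
    apply (simp only: s divide_inverse inverse_mult_distrib inverse_minus_eq power2_eq_square)
    apply (simp add: algebra_simps s(21-))
    done
qed

end

section \<open>The curvature of the Kerr-Newman-(anti-)de Sitter frame\<close>

text \<open>
  Tables are selections and not nested vectors: with \<open>sel4_cong\<close> the simplifier leaves the entries
  that are not selected alone.
\<close>

definition sel4 :: "4 \<Rightarrow> 'a \<Rightarrow> 'a \<Rightarrow> 'a \<Rightarrow> 'a \<Rightarrow> 'a" where
  "sel4 i a b c d = (if i = 1 then a else if i = 2 then b else if i = 3 then c else d)"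

lemma sel4_simps: "sel4 1 a b c d = a" "sel4 2 a b c d = b" "sel4 3 a b c d = c" "sel4 4 a b c d = d"
  by (simp_all add: sel4_def)

lemma sel4_cong: "i = j \<Longrightarrow> sel4 i a b c d = sel4 j a b c d" by simp

text \<open>
  Primed variables stand for inverses, and \<open>Q1\<close>, \<open>Q2\<close>, \<open>X1\<close>, \<open>X2\<close> for half the first and second derivatives
  of \<open>Q\<close> and \<open>X\<close>, so that all entries are polynomials with integer coefficients.
\<close>

definition connection :: "real \<Rightarrow> real \<Rightarrow> real \<Rightarrow> real \<Rightarrow> real \<Rightarrow> real \<Rightarrow> real \<Rightarrow> real \<Rightarrow> real \<Rightarrow> real \<Rightarrow> 4 \<Rightarrow> 4 \<Rightarrow> 4 \<Rightarrow> real" where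
  "connection a r x Q Q' Q1 X X' X1 R' e c d =
    sel4 e (sel4 c (sel4 d 0 (- (r * R') + Q' * Q1) (a^2 * x * R') 0)
      (sel4 d (- (r * Q^2 * R'^3) + Q * Q1 * R'^2) 0 0 (a * r * Q * X * R'^3))
      (sel4 d (a^2 * x * Q * X * R'^3) 0 0 (- (a * x * Q * X * R'^3)))
      (sel4 d 0 (- (a * r * R')) (a * x * Q * X' * R') 0))
    (sel4 c (sel4 d (- (r * R') + Q' * Q1) 0 0 (a * r * Q' * X * R'))
      (sel4 d 0 (r * R' - Q' * Q1) (a^2 * x * R') 0)
      (sel4 d 0 (- (a^2 * x * Q' * X * R')) (r * R') 0)
      (sel4 d (a * r * R') 0 0 (- (r * R'))))
    (sel4 c (sel4 d (- (a^2 * x * R')) 0 0 (a * x * R'))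
      (sel4 d 0 (a^2 * x * R') (- (r * Q * X' * R')) 0)
      (sel4 d 0 (r * R') (a^2 * x * R' - X' * X1) 0)
      (sel4 d (a * x * Q * X' * R') 0 0 (- (a^2 * x * R') + X' * X1)))
    (sel4 c (sel4 d 0 (a * r * Q' * X * R') (- (a * x * R')) 0)
      (sel4 d (a * r * Q * X * R'^3) 0 0 (- (r * Q * X * R'^3)))
      (sel4 d (- (a * x * Q * X * R'^3)) 0 0 (a^2 * x * X^2 * R'^3 - X * X1 * R'^2))
      (sel4 d 0 (r * R') (- (a^2 * x * R') + X' * X1) 0))"

definition connection_r :: "real \<Rightarrow> real \<Rightarrow> real \<Rightarrow> real \<Rightarrow> real \<Rightarrow> real \<Rightarrow> real \<Rightarrow> real \<Rightarrow> real \<Rightarrow> real \<Rightarrow> real \<Rightarrow> 4 \<Rightarrow> 4 \<Rightarrow> 4 \<Rightarrow> real" where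
  "connection_r a r x Q Q' Q1 X X' X1 R' Q2 e c d =
    sel4 e (sel4 c (sel4 d 0 (2 * r^2 * R'^2 - R' + Q' * Q2 - 2 * Q'^2 * Q1^2) (- (2 * a^2 * r * x * R'^2)) 0)
      (sel4 d (6 * r^2 * Q^2 * R'^4 - 8 * r * Q * Q1 * R'^3 - Q^2 * R'^3 + Q * Q2 * R'^2 + 2 * Q1^2 * R'^2) 0 0 (- (6 * a * r^2 * Q * X * R'^4) + 2 * a * r * Q1 * X * R'^3 + a * Q * X * R'^3))
      (sel4 d (- (6 * a^2 * r * x * Q * X * R'^4) + 2 * a^2 * x * Q1 * X * R'^3) 0 0 (6 * a * r * x * Q * X * R'^4 - 2 * a * x * Q1 * X * R'^3))
      (sel4 d 0 (2 * a * r^2 * R'^2 - a * R') (- (2 * a * r * x * Q * X' * R'^2) + 2 * a * x * Q1 * X' * R') 0))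
    (sel4 c (sel4 d (2 * r^2 * R'^2 - R' + Q' * Q2 - 2 * Q'^2 * Q1^2) 0 0 (- (2 * a * r^2 * Q' * X * R'^2) - 2 * a * r * Q'^2 * Q1 * X * R' + a * Q' * X * R'))
      (sel4 d 0 (- (2 * r^2 * R'^2) + R' - Q' * Q2 + 2 * Q'^2 * Q1^2) (- (2 * a^2 * r * x * R'^2)) 0)
      (sel4 d 0 (2 * a^2 * r * x * Q' * X * R'^2 + 2 * a^2 * x * Q'^2 * Q1 * X * R') (- (2 * r^2 * R'^2) + R') 0)
      (sel4 d (- (2 * a * r^2 * R'^2) + a * R') 0 0 (2 * r^2 * R'^2 - R')))
    (sel4 c (sel4 d (2 * a^2 * r * x * R'^2) 0 0 (- (2 * a * r * x * R'^2)))
      (sel4 d 0 (- (2 * a^2 * r * x * R'^2)) (2 * r^2 * Q * X' * R'^2 - 2 * r * Q1 * X' * R' - Q * X' * R') 0)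
      (sel4 d 0 (- (2 * r^2 * R'^2) + R') (- (2 * a^2 * r * x * R'^2)) 0)
      (sel4 d (- (2 * a * r * x * Q * X' * R'^2) + 2 * a * x * Q1 * X' * R') 0 0 (2 * a^2 * r * x * R'^2)))
    (sel4 c (sel4 d 0 (- (2 * a * r^2 * Q' * X * R'^2) - 2 * a * r * Q'^2 * Q1 * X * R' + a * Q' * X * R') (2 * a * r * x * R'^2) 0)
      (sel4 d (- (6 * a * r^2 * Q * X * R'^4) + 2 * a * r * Q1 * X * R'^3 + a * Q * X * R'^3) 0 0 (6 * r^2 * Q * X * R'^4 - 2 * r * Q1 * X * R'^3 - Q * X * R'^3))
      (sel4 d (6 * a * r * x * Q * X * R'^4 - 2 * a * x * Q1 * X * R'^3) 0 0 (- (6 * a^2 * r * x * X^2 * R'^4) + 4 * r * X * X1 * R'^3))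
      (sel4 d 0 (- (2 * r^2 * R'^2) + R') (2 * a^2 * r * x * R'^2) 0))"

definition connection_x :: "real \<Rightarrow> real \<Rightarrow> real \<Rightarrow> real \<Rightarrow> real \<Rightarrow> real \<Rightarrow> real \<Rightarrow> real \<Rightarrow> real \<Rightarrow> real \<Rightarrow> real \<Rightarrow> 4 \<Rightarrow> 4 \<Rightarrow> 4 \<Rightarrow> real" where
  "connection_x a r x Q Q' Q1 X X' X1 R' X2 e c d =
    sel4 e (sel4 c (sel4 d 0 (2 * a^2 * r * x * R'^2) (- (2 * a^4 * x^2 * R'^2) + a^2 * R') 0)
      (sel4 d (6 * a^2 * r * x * Q^2 * R'^4 - 4 * a^2 * x * Q * Q1 * R'^3) 0 0 (- (6 * a^3 * r * x * Q * X * R'^4) + 2 * a * r * Q * X1 * R'^3))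
      (sel4 d (- (6 * a^4 * x^2 * Q * X * R'^4) + 2 * a^2 * x * Q * X1 * R'^3 + a^2 * Q * X * R'^3) 0 0 (6 * a^3 * x^2 * Q * X * R'^4 - 2 * a * x * Q * X1 * R'^3 - a * Q * X * R'^3))
      (sel4 d 0 (2 * a^3 * r * x * R'^2) (- (2 * a^3 * x^2 * Q * X' * R'^2) - 2 * a * x * Q * X'^2 * X1 * R' + a * Q * X' * R') 0))
    (sel4 c (sel4 d (2 * a^2 * r * x * R'^2) 0 0 (- (2 * a^3 * r * x * Q' * X * R'^2) + 2 * a * r * Q' * X1 * R'))
      (sel4 d 0 (- (2 * a^2 * r * x * R'^2)) (- (2 * a^4 * x^2 * R'^2) + a^2 * R') 0)
      (sel4 d 0 (2 * a^4 * x^2 * Q' * X * R'^2 - 2 * a^2 * x * Q' * X1 * R' - a^2 * Q' * X * R') (- (2 * a^2 * r * x * R'^2)) 0)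
      (sel4 d (- (2 * a^3 * r * x * R'^2)) 0 0 (2 * a^2 * r * x * R'^2)))
    (sel4 c (sel4 d (2 * a^4 * x^2 * R'^2 - a^2 * R') 0 0 (- (2 * a^3 * x^2 * R'^2) + a * R'))
      (sel4 d 0 (- (2 * a^4 * x^2 * R'^2) + a^2 * R') (2 * a^2 * r * x * Q * X' * R'^2 + 2 * r * Q * X'^2 * X1 * R') 0)
      (sel4 d 0 (- (2 * a^2 * r * x * R'^2)) (- (2 * a^4 * x^2 * R'^2) + a^2 * R' - X' * X2 + 2 * X'^2 * X1^2) 0)
      (sel4 d (- (2 * a^3 * x^2 * Q * X' * R'^2) - 2 * a * x * Q * X'^2 * X1 * R' + a * Q * X' * R') 0 0 (2 * a^4 * x^2 * R'^2 - a^2 * R' + X' * X2 - 2 * X'^2 * X1^2)))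
    (sel4 c (sel4 d 0 (- (2 * a^3 * r * x * Q' * X * R'^2) + 2 * a * r * Q' * X1 * R') (2 * a^3 * x^2 * R'^2 - a * R') 0)
      (sel4 d (- (6 * a^3 * r * x * Q * X * R'^4) + 2 * a * r * Q * X1 * R'^3) 0 0 (6 * a^2 * r * x * Q * X * R'^4 - 2 * r * Q * X1 * R'^3))
      (sel4 d (6 * a^3 * x^2 * Q * X * R'^4 - 2 * a * x * Q * X1 * R'^3 - a * Q * X * R'^3) 0 0 (- (6 * a^4 * x^2 * X^2 * R'^4) + 8 * a^2 * x * X * X1 * R'^3 + a^2 * X^2 * R'^3 - X * X2 * R'^2 - 2 * X1^2 * R'^2))
      (sel4 d 0 (- (2 * a^2 * r * x * R'^2)) (2 * a^4 * x^2 * R'^2 - a^2 * R' + X' * X2 - 2 * X'^2 * X1^2) 0))"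

definition frame_metric :: "real \<Rightarrow> real \<Rightarrow> real \<Rightarrow> real \<Rightarrow> real \<Rightarrow> real \<Rightarrow> 4 \<Rightarrow> real" where
  "frame_metric Q Q' X X' R R' c = sel4 c (- Q * R') (R * Q') (R * X') (X * R')"

locale kn_point =
  fixes a m q L r x Q Q' Q1 Q2 X X' X1 X2 R R' P N :: real
  assumes R: "R = r^2 + a^2 * x^2" and RR': "R * R' = 1" and QQ': "Q * Q' = 1" and XX': "X * X' = 1"
    and Q: "Q = (1 - L * r^2) * (r^2 + a^2) - 2 * m * r + q^2"
    and Q1: "Q1 = r - L * r * (2 * r^2 + a^2) - m"
    and Q2: "Q2 = 1 - L * (6 * r^2 + a^2)"
    and X: "X = (1 - x^2) * (1 + a^2 * L * x^2)"
    and X1: "X1 = - x * (1 + a^2 * L * x^2) + a^2 * L * x * (1 - x^2)"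
    and X2: "X2 = - 1 + a^2 * L * (1 - 6 * x^2)"
    and P: "P = ((r^2 - a^2 * x^2) * (q^2 - m * r) + 2 * a^2 * m * r * x^2) * R'^3"
    and N: "N = (2 * a * r * x * (q^2 - m * r) - (r^2 - a^2 * x^2) * m * a * x) * R'^3"
begin

abbreviation "g4 \<equiv> connection a r x Q Q' Q1 X X' X1 R'"

abbreviation "G4 \<equiv> frame_metric Q Q' X X' R R'"

definition dg4 :: "4 \<Rightarrow> 4 \<Rightarrow> 4 \<Rightarrow> 4 \<Rightarrow> real" where
  "dg4 f e c d = sel4 f 0 (connection_r a r x Q Q' Q1 X X' X1 R' Q2 e c d) (connection_x a r x Q Q' Q1 X X' X1 R' X2 e c d) 0"

definition dG4 :: "4 \<Rightarrow> 4 \<Rightarrow> real" where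
  "dG4 e c = sel4 e 0 (sel4 c (2 * r * Q * R'^2 - 2 * Q1 * R') (2 * r * Q' - 2 * R * Q1 * Q'^2) (2 * r * X') (- 2 * r * X * R'^2))
     (sel4 c (2 * a^2 * x * Q * R'^2) (2 * a^2 * x * Q') (2 * a^2 * x * X' - 2 * R * X1 * X'^2) (2 * X1 * R' - 2 * a^2 * x * X * R'^2)) 0"

definition curv4 :: "4 \<Rightarrow> 4 \<Rightarrow> 4 \<Rightarrow> 4 \<Rightarrow> real" where
  "curv4 c d e f = dg4 e f c d - dg4 f e c d
     + (\<Sum>h\<in>UNIV. g4 e c h * g4 f h d - g4 f c h * g4 e h d)
     - (\<Sum>h\<in>UNIV. (g4 e h f - g4 f h e) * g4 h c d)"

text \<open>The part of the Riemann tensor that comes from the cosmological constant ($L=\Lambda/3$) and the charge.\<close>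

definition rest4 :: "4 \<Rightarrow> 4 \<Rightarrow> 4 \<Rightarrow> 4 \<Rightarrow> real" where
  "rest4 i j k l = (q^2 * R'^2 - L) * (wedge 1 2 i j * wedge 1 2 k l) + (q^2 * R'^2 + L) * (wedge 3 4 i j * wedge 3 4 k l)
    + L * (G4 1 * G4 3 * wedge 1 3 i j * wedge 1 3 k l + G4 1 * G4 4 * wedge 1 4 i j * wedge 1 4 k l
       + G4 2 * G4 3 * wedge 2 3 i j * wedge 2 3 k l + G4 2 * G4 4 * wedge 2 4 i j * wedge 2 4 k l)"

lemma inverse_cancel: "R * R' = 1" "R * (R' * z) = z" "Q * Q' = 1" "Q * (Q' * z) = z" "X * X' = 1" "X * (X' * z) = z"
  using RR' QQ' XX' by (simp_all flip: mult.assoc)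

lemma nz: "R \<noteq> 0" "Q \<noteq> 0" "X \<noteq> 0" "R' \<noteq> 0" "Q' \<noteq> 0" "X' \<noteq> 0"
  using RR' QQ' XX' by auto

lemma cancel_factor: "W \<noteq> 0 \<Longrightarrow> W * A = W * B \<Longrightarrow> A = B" for W A B :: real
  by simp

lemmas wedge_eval = wedge_table wedge_same wedge_flip(2)[of _ _ 2 1] wedge_flip(2)[of _ _ 3 1] wedge_flip(2)[of _ _ 4 1]
   wedge_flip(2)[of _ _ 3 2] wedge_flip(2)[of _ _ 4 2] wedge_flip(2)[of _ _ 4 3]

lemmas table_simps = dg4_def curv4_def rest4_def sum_4 connection_def connection_r_def connection_x_def typeD_def frame_metric_def sel4_simps wedge_eval P N

lemmas zero_one_simps = mult_zero_left mult_zero_right add_0_left add_0_right diff_0 diff_0_right minus_zero mult_1_left mult_1_right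

text \<open>
  Both sides of these components are a monomial in \<open>Q\<close>, \<open>X\<close>, \<open>R\<close> times an expression that is linear in \<open>Q\<close>, \<open>X\<close>
  and their derivatives; removing the monomial first keeps the polynomial identities small.
\<close>

lemma curv4_diag_13:
  "G4 1 * curv4 1 3 1 3 = typeD G4 P N 1 3 1 3 + rest4 1 3 1 3"
  "G4 3 * curv4 3 1 1 3 = typeD G4 P N 3 1 1 3 + rest4 3 1 1 3"
proof -
  have W: "R^3 * Q' * X \<noteq> 0" by (simp add: nz)
  show "G4 1 * curv4 1 3 1 3 = typeD G4 P N 1 3 1 3 + rest4 1 3 1 3"
   "G4 3 * curv4 3 1 1 3 = typeD G4 P N 3 1 1 3 + rest4 3 1 1 3"
    by (rule cancel_factor[OF W],
     (simp only: table_simps cong: sel4_cong;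
     (simp only: zero_one_simps power2_eq_square power3_eq_cube power4_eq_xxxx;
     (simp only: ring_distribs mult_minus_left mult_minus_right minus_minus;
     (simp only: mult_ac mult_minus_left mult_minus_right minus_minus inverse_cancel;
     (unfold R Q Q1 Q2 X X1 X2 power2_eq_square, algebra)?)?)?)?))+
qed

lemma curv4_diag_14:
  "G4 1 * curv4 1 4 1 4 = typeD G4 P N 1 4 1 4 + rest4 1 4 1 4"
  "G4 4 * curv4 4 1 1 4 = typeD G4 P N 4 1 1 4 + rest4 4 1 1 4"
proof -
  have W: "R^3 * R^2 * Q' * X' \<noteq> 0" by (simp add: nz)
  show "G4 1 * curv4 1 4 1 4 = typeD G4 P N 1 4 1 4 + rest4 1 4 1 4"
   "G4 4 * curv4 4 1 1 4 = typeD G4 P N 4 1 1 4 + rest4 4 1 1 4"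
    by (rule cancel_factor[OF W],
     (simp only: table_simps cong: sel4_cong;
     (simp only: zero_one_simps power2_eq_square power3_eq_cube power4_eq_xxxx;
     (simp only: ring_distribs mult_minus_left mult_minus_right minus_minus;
     (simp only: mult_ac mult_minus_left mult_minus_right minus_minus inverse_cancel;
     (unfold R Q Q1 Q2 X X1 X2 power2_eq_square, algebra)?)?)?)?))+
qed

lemma curv4_diag_23:
  "G4 2 * curv4 2 3 2 3 = typeD G4 P N 2 3 2 3 + rest4 2 3 2 3"
  "G4 3 * curv4 3 2 2 3 = typeD G4 P N 3 2 2 3 + rest4 3 2 2 3"
proof -
  have W: "R * Q * X \<noteq> 0" by (simp add: nz)
  show "G4 2 * curv4 2 3 2 3 = typeD G4 P N 2 3 2 3 + rest4 2 3 2 3"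
   "G4 3 * curv4 3 2 2 3 = typeD G4 P N 3 2 2 3 + rest4 3 2 2 3"
    by (rule cancel_factor[OF W],
     (simp only: table_simps cong: sel4_cong;
     (simp only: zero_one_simps power2_eq_square power3_eq_cube power4_eq_xxxx;
     (simp only: ring_distribs mult_minus_left mult_minus_right minus_minus;
     (simp only: mult_ac mult_minus_left mult_minus_right minus_minus inverse_cancel;
     (unfold R Q Q1 Q2 X X1 X2 power2_eq_square, algebra)?)?)?)?))+
qed

lemma curv4_diag_24:
  "G4 2 * curv4 2 4 2 4 = typeD G4 P N 2 4 2 4 + rest4 2 4 2 4"
  "G4 4 * curv4 4 2 2 4 = typeD G4 P N 4 2 2 4 + rest4 4 2 2 4"
proof -
  have W: "R^3 * Q * X' \<noteq> 0" by (simp add: nz)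
  show "G4 2 * curv4 2 4 2 4 = typeD G4 P N 2 4 2 4 + rest4 2 4 2 4"
   "G4 4 * curv4 4 2 2 4 = typeD G4 P N 4 2 2 4 + rest4 4 2 2 4"
    by (rule cancel_factor[OF W],
     (simp only: table_simps cong: sel4_cong;
     (simp only: zero_one_simps power2_eq_square power3_eq_cube power4_eq_xxxx;
     (simp only: ring_distribs mult_minus_left mult_minus_right minus_minus;
     (simp only: mult_ac mult_minus_left mult_minus_right minus_minus inverse_cancel;
     (unfold R Q Q1 Q2 X X1 X2 power2_eq_square, algebra)?)?)?)?))+
qed

lemma cancel_R4: "R^4 * A = R^4 * B \<Longrightarrow> A = B"
  using RR' by auto

lemma curv4_less: "\<forall>c d.
    G4 c * curv4 c d 1 2 = typeD G4 P N c d 1 2 + rest4 c d 1 2 \<and>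
    G4 c * curv4 c d 1 3 = typeD G4 P N c d 1 3 + rest4 c d 1 3 \<and>
    G4 c * curv4 c d 1 4 = typeD G4 P N c d 1 4 + rest4 c d 1 4 \<and>
    G4 c * curv4 c d 2 3 = typeD G4 P N c d 2 3 + rest4 c d 2 3 \<and>
    G4 c * curv4 c d 2 4 = typeD G4 P N c d 2 4 + rest4 c d 2 4 \<and>
    G4 c * curv4 c d 3 4 = typeD G4 P N c d 3 4 + rest4 c d 3 4"
  unfolding forall_4
  by (intro conjI; (rule curv4_diag_13 curv4_diag_14 curv4_diag_23 curv4_diag_24 | (rule cancel_R4,
     (simp only: table_simps cong: sel4_cong;
     (simp only: zero_one_simps power2_eq_square power3_eq_cube power4_eq_xxxx;
     (simp only: ring_distribs mult_minus_left mult_minus_right minus_minus;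
     (simp only: mult_ac mult_minus_left mult_minus_right minus_minus inverse_cancel;
     (unfold R Q Q1 Q2 X X1 X2 power2_eq_square, algebra)?)?)?)?))))

lemma antisym_34:
  "curv4 c d f e = - curv4 c d e f" "typeD G P N c d f e = - typeD G P N c d e f" "rest4 c d f e = - rest4 c d e f"
proof -
  show "curv4 c d f e = - curv4 c d e f"
    by (simp add: curv4_def sum_subtractf left_diff_distrib)
  show "typeD G P N c d f e = - typeD G P N c d e f" "rest4 c d f e = - rest4 c d e f"
    unfolding typeD_def rest4_def wedge_flip(2)[of _ _ f e] by (simp_all add: algebra_simps)
qed

lemma curv4_eq: "G4 c * curv4 c d e f = typeD G4 P N c d e f + rest4 c d e f"
proof -
  let ?P = "\<lambda>e f. G4 c * curv4 c d e f = typeD G4 P N c d e f + rest4 c d e f"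
  have swap: "?P e f \<Longrightarrow> ?P f e" for e f
    unfolding antisym_34(1)[of c d f e] antisym_34(2)[of G4 c d f e] antisym_34(3)[of c d f e] by simp
  have same: "?P e e" for e
    using antisym_34(1)[of c d e e] antisym_34(2)[of G4 c d e e] antisym_34(3)[of c d e e] by simp
  have less: "?P 1 2" "?P 1 3" "?P 1 4" "?P 2 3" "?P 2 4" "?P 3 4" using curv4_less by blast+
  have "\<forall>e f. ?P e f" unfolding forall_4 by (intro conjI same less less[THEN swap])
  then show ?thesis by blast
qed

lemma adapted_G4: "adapted G4 (dG4 e) (g4 e)"
proof
  show "G4 1 * G4 2 = -1" "G4 3 * G4 4 = 1"
    by (simp_all add: frame_metric_def sel4_simps mult_ac inverse_cancel)
  have "\<forall>e. g4 e 1 1 + g4 e 2 2 = 0 \<and> g4 e 3 3 + g4 e 4 4 = 0"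
    unfolding forall_4 by (simp only: connection_def sel4_simps cong: sel4_cong) simp
  then show "g4 e 1 1 + g4 e 2 2 = 0" "g4 e 3 3 + g4 e 4 4 = 0" by blast+
  have "\<forall>e c d. (if c = d then dG4 e c else 0) = G4 c * g4 e c d + G4 d * g4 e d c"
    unfolding forall_4
    by (intro conjI; simp only: connection_def dG4_def frame_metric_def sel4_simps cong: sel4_cong;
       simp add: algebra_simps power2_eq_square power3_eq_cube inverse_cancel)
  then show "(if c = d then dG4 e c else 0) = G4 c * g4 e c d + G4 d * g4 e d c" for c d by blast
qed

lemma frame_metric_diag: "(if a' = c then G4 a' else 0) = (\<Sum>i\<in>UNIV. G4 i * delta i a' * delta i c)"
proof -
  have "G4 i * delta i a' * delta i c = (if i = c then (if a' = c then G4 c else 0) else 0)" for i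
    by (simp add: delta_def)
  then show ?thesis by simp
qed

lemma G4_nonzero: "G4 c \<noteq> 0"
  using exhaust_4[of c] by (auto simp: frame_metric_def sel4_simps nz)

definition ric4 :: "4 \<Rightarrow> 4 \<Rightarrow> real" where
  "ric4 i j = (3 * L - q^2 * R'^2) * (G4 1 * delta 1 i * delta 1 j + G4 2 * delta 2 i * delta 2 j)
        + (3 * L + q^2 * R'^2) * (G4 3 * delta 3 i * delta 3 j + G4 4 * delta 4 i * delta 4 j)"

lemma ric4_eq: "(\<Sum>c\<in>UNIV. curv4 c i c j) = ric4 i j"
proof -
  interpret ad: adapted G4 "dG4 1" "g4 1" by (rule adapted_G4)
  have "curv4 c i c j = (typeD G4 P N c i c j + rest4 c i c j) / G4 c" for c i j
    unfolding curv4_eq[symmetric] by (simp add: G4_nonzero)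
  moreover have "\<forall>i j. (\<Sum>c\<in>UNIV. (typeD G4 P N c i c j + rest4 c i c j) / G4 c) = ric4 i j"
    unfolding forall_4 sum_4 typeD_def rest4_def ric4_def
    by (intro conjI; simp add: wedge_eval delta_def ad.compatible_simps G4_nonzero; simp add: field_simps G4_nonzero)
  ultimately show ?thesis by simp
qed

lemma scal4_eq: "(\<Sum>c\<in>UNIV. ric4 c c / G4 c) = 12 * L"
  by (simp add: sum_4 ric4_def delta_def G4_nonzero)

lemma weyl4_eq:
  defines "h \<equiv> \<lambda>i j. if i = j then G4 i else 0"
  shows "G4 i * curv4 i j k l
     - 1/2 * (h i k * ric4 j l - h i l * ric4 j k - ric4 i l * h j k + ric4 i k * h j l)
     + 1/6 * (12 * L) * (h i k * h j l - h i l * h j k) = typeD G4 P N i j k l"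
proof -
  interpret ad: adapted G4 "dG4 1" "g4 1" by (rule adapted_G4)
  have h: "h i j = G4 1 * delta 1 i * delta 1 j + G4 2 * delta 2 i * delta 2 j + G4 3 * delta 3 i * delta 3 j + G4 4 * delta 4 i * delta 4 j" for i j
    using frame_metric_diag[of i j] by (simp add: h_def sum_4)
  have r: "rest4 i j k l = (L - q^2 * R'^2) * (G4 1 * G4 2 * wedge 1 2 i j * wedge 1 2 k l) + (L + q^2 * R'^2) * (G4 3 * G4 4 * wedge 3 4 i j * wedge 3 4 k l)
    + L * (G4 1 * G4 3 * wedge 1 3 i j * wedge 1 3 k l + G4 1 * G4 4 * wedge 1 4 i j * wedge 1 4 k l
       + G4 2 * G4 3 * wedge 2 3 i j * wedge 2 3 k l + G4 2 * G4 4 * wedge 2 4 i j * wedge 2 4 k l)"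
    by (simp add: rest4_def ad.G12 ad.G34 algebra_simps)
  have "rest4 i j k l = 1/2 * (h i k * ric4 j l - h i l * ric4 j k - ric4 i l * h j k + ric4 i k * h j l)
     - 1/6 * (12 * L) * (h i k * h j l - h i l * h j k)"
    unfolding r h ric4_def wedge_def by algebra
  then show ?thesis by (simp add: curv4_eq)
qed

end

lemma I4_polynomial_identity:
  fixes a m q L r x :: real
  defines "Q \<equiv> (1 - L * r^2) * (r^2 + a^2) - 2 * m * r + q^2"
    and "X \<equiv> (1 - x^2) * (1 + a^2 * L * x^2)" and "R \<equiv> r^2 + a^2 * x^2"
    and "p \<equiv> (r^2 - a^2 * x^2) * (q^2 - m * r) + 2 * a^2 * m * r * x^2"
    and "n \<equiv> 2 * a * r * x * (q^2 - m * r) - (r^2 - a^2 * x^2) * m * a * x"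
    and "pr \<equiv> 2 * r * (q^2 - m * r) - m * (r^2 - a^2 * x^2) + 2 * a^2 * m * x^2"
    and "px \<equiv> - 2 * a^2 * x * (q^2 - m * r) + 4 * a^2 * m * r * x"
    and "nr \<equiv> 2 * a * x * (q^2 - m * r) - 2 * a * r * x * m - 2 * r * m * a * x"
    and "nx \<equiv> 2 * a * r * (q^2 - m * r) + 2 * a^2 * x * m * a * x - (r^2 - a^2 * x^2) * m * a"
  shows "- 96 * (Q * (pr * R - 6 * r * p) * (nr * R - 6 * r * n) + X * (px * R - 6 * a^2 * x * p) * (nx * R - 6 * a^2 * x * n))
    - 576 * (Q - a^2 * X) * ((p^2 - n^2) * (a * r * x) + p * n * (r^2 - a^2 * x^2)) =
    1920 * a * x * (
      a^10 * m * (3 * L) * (m * r - 3 * q^2 / 10) * x^10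
    - a^8 * (7 * (3 * L) * m^2 * r^3 - 57 * (3 * L) * m * q^2 * r^2 / 10
        + (a^2 * m^2 * (3 * L) + 29/30 * q^4 * (3 * L) - 3 * m^2) * r
        - 3 * m * q^2 * ((3 * L) * a^2 - 3) / 10) * x^8
    + 6 * a^6 * ((3 * L) * m^2 * r^5 - 83 * m * q^2 * r^4 * (3 * L) / 60
        + (a^2 * m^2 * (3 * L) + 37/90 * q^4 * (3 * L) - 3 * m^2) * r^3
        - 11 * (a^2 * (3 * L) * q^2 + 12/11 * m^2 - 3 * q^2) * m * r^2 / 12
        + 29 * (a^2 * (3 * L) * q^2 + 126/29 * m^2 - 3 * q^2) * q^2 * r / 180
        + m * q^2 * (a^2 - 2 * q^2) / 20) * x^6
    + 37 * a^4 * r / 10 * (60 * (3 * L) * m^2 * r^6 / 37 - 33 * r^5 * m * q^2 * (3 * L) / 37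
        + m * (a^2 * (3 * L) * q^2 + 420/37 * m^2 - 3 * q^2) * r^3
        - 19 * (a^2 * (3 * L) * q^2 + 498/19 * m^2 - 3 * q^2) * q^2 * r^2 / 37
        - 27 * (a^2 - 178 * q^2 / 27) * m * q^2 * r / 37
        + 12 * q^4 * a^2 / 37 - 17 * q^6 / 37) * x^4
    - 6 * a^2 * r^3 * (7 * (3 * L) * m^2 * r^6 / 6 - 3 * r^5 * m * q^2 * (3 * L) / 2
        + (a^2 * m^2 * (3 * L) + 37/90 * q^4 * (3 * L) - 3 * m^2) * r^4
        - 5 * m * (a^2 * (3 * L) * q^2 - 28/5 * m^2 - 3 * q^2) * r^3 / 4
        + 19 * (a^2 * (3 * L) * q^2 - 750/19 * m^2 - 3 * q^2) * q^2 * r^2 / 60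
        + (a^2 + 418 * q^2 / 15) * m * q^2 * r / 4
        - 37 * q^6 / 30) * x^2
    + r^5 * ((3 * L) * m^2 * r^6 - 2 * r^5 * m * q^2 * (3 * L)
        + (a^2 * m^2 * (3 * L) + 29/30 * q^4 * (3 * L) - 3 * m^2) * r^4
        - 2 * m * (a^2 * (3 * L) * q^2 - 3 * m^2 - 3 * q^2) * r^3
        + (29/30 * a^2 * q^4 * (3 * L) - 15 * m^2 * q^2 - 29/10 * q^4) * r^2
        + 3 * m * q^2 * (a^2 + 118 * q^2 / 15) * r / 2
        - 6 * q^4 * a^2 / 5 - 29 * q^6 / 10))"
  unfolding assms by algebra

section \<open>The metric in coordinates\<close>

lemma has_partial_r_theta:
  assumes "((\<lambda>r. f r (y $ 3)) has_field_derivative D2) (at (y $ 2))"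
    and "((\<lambda>\<theta>. f (y $ 2) \<theta>) has_field_derivative D3) (at (y $ 3))"
  shows "has_partial (\<lambda>y. f (y $ 2) (y $ 3)) (sel4 j 0 D2 D3 0) j y"
proof -
  have "\<forall>j. has_partial (\<lambda>y. f (y $ 2) (y $ 3)) (sel4 j 0 D2 D3 0) j y"
    unfolding forall_4 has_partial_def using assms by (simp add: shift_def sel4_simps)
  then show ?thesis by blast
qed

locale kerr_newman =
  fixes a m q \<Lambda> :: real
  assumes Xi_nonzero: "Xi a \<Lambda> \<noteq> 0"
begin

definition L where "L = \<Lambda> / 3"
definition "fR r x = r^2 + a^2 * x^2"
definition "fR' r x = inverse (fR r x)"
definition "fQ r = (1 - L * r^2) * (r^2 + a^2) - 2 * m * r + q^2"
definition "fQ' r = inverse (fQ r)"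
definition "fQ1 r = r - L * r * (2 * r^2 + a^2) - m"
definition "fQ2 r = 1 - L * (6 * r^2 + a^2)"
definition "fX x = (1 - x^2) * (1 + a^2 * L * x^2)"
definition "fX' x = inverse (fX x)"
definition "fX1 x = - x * (1 + a^2 * L * x^2) + a^2 * L * x * (1 - x^2)"
definition "fX2 x = - 1 + a^2 * L * (1 - 6 * x^2)"
definition "fp r x = (r^2 - a^2 * x^2) * (q^2 - m * r) + 2 * a^2 * m * r * x^2"
definition "fpr r x = 2 * r * (q^2 - m * r) - m * (r^2 - a^2 * x^2) + 2 * a^2 * m * x^2"
definition "fpx r x = - 2 * a^2 * x * (q^2 - m * r) + 4 * a^2 * m * r * x"
definition "fn r x = 2 * a * r * x * (q^2 - m * r) - (r^2 - a^2 * x^2) * m * a * x"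
definition "fnr r x = 2 * a * x * (q^2 - m * r) - 2 * a * r * x * m - 2 * r * m * a * x"
definition "fnx r x = 2 * a * r * (q^2 - m * r) + 2 * a^2 * x * m * a * x - (r^2 - a^2 * x^2) * m * a"
definition "fP r x = fp r x * fR' r x ^ 3"
definition "fN r x = fn r x * fR' r x ^ 3"
definition "fPr r x = (fpr r x * fR r x - 6 * r * fp r x) * fR' r x ^ 4"
definition "fPx r x = (fpx r x * fR r x - 6 * a^2 * x * fp r x) * fR' r x ^ 4"
definition "fNr r x = (fnr r x * fR r x - 6 * r * fn r x) * fR' r x ^ 4"
definition "fNx r x = (fnx r x * fR r x - 6 * a^2 * x * fn r x) * fR' r x ^ 4"

lemma kn_point_fields:
  assumes "fR r x \<noteq> 0" "fQ r \<noteq> 0" "fX x \<noteq> 0"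
  shows "kn_point a m q L r x (fQ r) (fQ' r) (fQ1 r) (fQ2 r) (fX x) (fX' x) (fX1 x) (fX2 x) (fR r x) (fR' r x) (fP r x) (fN r x)"
proof
  show "fR r x * fR' r x = 1" "fQ r * fQ' r = 1" "fX x * fX' x = 1"
    using assms by (simp_all add: fR'_def fQ'_def fX'_def)
qed (simp_all add: fR_def fQ_def fX_def fQ1_def fQ2_def fX1_def fX2_def fP_def fN_def fp_def fn_def)

abbreviation "\<gamma> r x \<equiv> connection a r x (fQ r) (fQ' r) (fQ1 r) (fX x) (fX' x) (fX1 x) (fR' r x)"
abbreviation "\<gamma>r r x \<equiv> connection_r a r x (fQ r) (fQ' r) (fQ1 r) (fX x) (fX' x) (fX1 x) (fR' r x) (fQ2 r)"
abbreviation "\<gamma>x r x \<equiv> connection_x a r x (fQ r) (fQ' r) (fQ1 r) (fX x) (fX' x) (fX1 x) (fR' r x) (fX2 x)"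
abbreviation "fG r x \<equiv> frame_metric (fQ r) (fQ' r) (fX x) (fX' x) (fR r x) (fR' r x)"
abbreviation "fdG r x \<equiv> kn_point.dG4 a r x (fQ r) (fQ' r) (fQ1 r) (fX x) (fX' x) (fX1 x) (fR r x) (fR' r x)"

lemma deriv_r:
  assumes "fR r x \<noteq> 0" "fQ r \<noteq> 0"
  shows "((\<lambda>r. fR r x) has_field_derivative 2 * r) (at r)"
    "((\<lambda>r. fR' r x) has_field_derivative - 2 * r * fR' r x ^ 2) (at r)"
    "(fQ has_field_derivative 2 * fQ1 r) (at r)"
    "(fQ' has_field_derivative - 2 * fQ1 r * fQ' r ^ 2) (at r)"
    "(fQ1 has_field_derivative fQ2 r) (at r)"
proof -
  show R: "((\<lambda>r. fR r x) has_field_derivative 2 * r) (at r)"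
    unfolding fR_def by (auto intro!: derivative_eq_intros)
  show Q: "(fQ has_field_derivative 2 * fQ1 r) (at r)"
    unfolding fQ_def[abs_def] fQ1_def by (auto intro!: derivative_eq_intros simp: algebra_simps power2_eq_square)
  show "(fQ1 has_field_derivative fQ2 r) (at r)"
    unfolding fQ1_def[abs_def] fQ2_def by (auto intro!: derivative_eq_intros simp: algebra_simps power2_eq_square)
  show "((\<lambda>r. fR' r x) has_field_derivative - 2 * r * fR' r x ^ 2) (at r)"
    unfolding fR'_def using assms(1)
    by (auto intro!: derivative_eq_intros R simp: power2_eq_square)
  show "(fQ' has_field_derivative - 2 * fQ1 r * fQ' r ^ 2) (at r)"
    unfolding fQ'_def[abs_def] using assms(2)
    by (auto intro!: derivative_eq_intros Q simp: power2_eq_square)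
qed

lemma deriv_x:
  assumes "fR r x \<noteq> 0" "fX x \<noteq> 0"
  shows "((\<lambda>x. fR r x) has_field_derivative 2 * a^2 * x) (at x)"
    "((\<lambda>x. fR' r x) has_field_derivative - 2 * a^2 * x * fR' r x ^ 2) (at x)"
    "(fX has_field_derivative 2 * fX1 x) (at x)"
    "(fX' has_field_derivative - 2 * fX1 x * fX' x ^ 2) (at x)"
    "(fX1 has_field_derivative fX2 x) (at x)"
proof -
  show R: "((\<lambda>x. fR r x) has_field_derivative 2 * a^2 * x) (at x)"
    unfolding fR_def by (auto intro!: derivative_eq_intros)
  show X: "(fX has_field_derivative 2 * fX1 x) (at x)"
    unfolding fX_def[abs_def] fX1_def by (auto intro!: derivative_eq_intros simp: algebra_simps power2_eq_square)
  show "(fX1 has_field_derivative fX2 x) (at x)"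
    unfolding fX1_def[abs_def] fX2_def by (auto intro!: derivative_eq_intros simp: algebra_simps power2_eq_square)
  show "((\<lambda>x. fR' r x) has_field_derivative - 2 * a^2 * x * fR' r x ^ 2) (at x)"
    unfolding fR'_def using assms(1)
    by (auto intro!: derivative_eq_intros R simp: power2_eq_square)
  show "(fX' has_field_derivative - 2 * fX1 x * fX' x ^ 2) (at x)"
    unfolding fX'_def[abs_def] using assms(2)
    by (auto intro!: derivative_eq_intros X simp: power2_eq_square)
qed

lemmas DERIV_ring = DERIV_const DERIV_ident DERIV_add DERIV_diff DERIV_minus DERIV_power DERIV_mult

lemma connection_deriv_r:
  assumes "fR r x \<noteq> 0" "fQ r \<noteq> 0"
  shows "((\<lambda>r. \<gamma> r x e c d) has_field_derivative \<gamma>r r x e c d) (at r)"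
proof -
  have "\<forall>e c d. ((\<lambda>r. \<gamma> r x e c d) has_field_derivative \<gamma>r r x e c d) (at r)"
    unfolding forall_4
    by (intro conjI; simp only: connection_def connection_r_def sel4_simps cong: sel4_cong;
        rule DERIV_cong, (rule deriv_r[OF assms] DERIV_ring)+,
        simp add: algebra_simps power2_eq_square power3_eq_cube power4_eq_xxxx)
  then show ?thesis by blast
qed

lemma connection_deriv_x:
  assumes "fR r x \<noteq> 0" "fX x \<noteq> 0"
  shows "((\<lambda>x. \<gamma> r x e c d) has_field_derivative \<gamma>x r x e c d) (at x)"
proof -
  have "\<forall>e c d. ((\<lambda>x. \<gamma> r x e c d) has_field_derivative \<gamma>x r x e c d) (at x)"
    unfolding forall_4
    by (intro conjI; simp only: connection_def connection_x_def sel4_simps cong: sel4_cong;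
        rule DERIV_cong, (rule deriv_x[OF assms] DERIV_ring)+,
        simp add: algebra_simps power2_eq_square power3_eq_cube power4_eq_xxxx)
  then show ?thesis by blast
qed

lemma PN_deriv:
  assumes "fR r x \<noteq> 0" "fQ r \<noteq> 0" "fX x \<noteq> 0"
  shows "((\<lambda>r. fP r x) has_field_derivative fPr r x) (at r)"
    "((\<lambda>r. fN r x) has_field_derivative fNr r x) (at r)"
    "((\<lambda>x. fP r x) has_field_derivative fPx r x) (at x)"
    "((\<lambda>x. fN r x) has_field_derivative fNx r x) (at x)"
proof -
  have "fR r x * fR' r x = 1" using assms(1) by (simp add: fR'_def)
  then have R3: "fR' r x ^ 3 = fR r x * fR' r x ^ 4" by algebra
  have p: "((\<lambda>r. fp r x) has_field_derivative fpr r x) (at r)" "((\<lambda>r. fn r x) has_field_derivative fnr r x) (at r)"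
    "((\<lambda>x. fp r x) has_field_derivative fpx r x) (at x)" "((\<lambda>x. fn r x) has_field_derivative fnx r x) (at x)"
    unfolding fp_def fn_def fpr_def fnr_def fpx_def fnx_def
    by (rule DERIV_cong, (rule DERIV_ring)+, simp add: algebra_simps power2_eq_square)+
  show "((\<lambda>r. fP r x) has_field_derivative fPr r x) (at r)"
    "((\<lambda>r. fN r x) has_field_derivative fNr r x) (at r)"
    "((\<lambda>x. fP r x) has_field_derivative fPx r x) (at x)"
    "((\<lambda>x. fN r x) has_field_derivative fNx r x) (at x)"
    unfolding fP_def fN_def fPr_def fNr_def fPx_def fNx_def left_diff_distrib mult.assoc R3[symmetric]
    by (rule DERIV_cong, (rule p deriv_r[OF assms(1,2)] deriv_x[OF assms(1,3)] DERIV_ring)+,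
        simp add: algebra_simps power2_eq_square power3_eq_cube power4_eq_xxxx)+
qed

lemma fG_deriv:
  assumes "fR r x \<noteq> 0" "fQ r \<noteq> 0" "fX x \<noteq> 0"
  shows "((\<lambda>r. fG r x c) has_field_derivative fdG r x 2 c) (at r)"
    "((\<lambda>x. fG r x c) has_field_derivative fdG r x 3 c) (at x)"
proof -
  interpret kn_point a m q L r x "fQ r" "fQ' r" "fQ1 r" "fQ2 r" "fX x" "fX' x" "fX1 x" "fX2 x" "fR r x" "fR' r x" "fP r x" "fN r x"
    by (rule kn_point_fields[OF assms])
  have "\<forall>c. ((\<lambda>r. fG r x c) has_field_derivative fdG r x 2 c) (at r)"
    "\<forall>c. ((\<lambda>x. fG r x c) has_field_derivative fdG r x 3 c) (at x)"
    unfolding forall_4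
    by (intro conjI; simp only: frame_metric_def dG4_def sel4_simps cong: sel4_cong;
        rule DERIV_cong, (rule deriv_r[OF assms(1,2)] deriv_x[OF assms(1,3)] DERIV_ring)+,
        simp add: algebra_simps power2_eq_square power3_eq_cube power4_eq_xxxx)+
  then show "((\<lambda>r. fG r x c) has_field_derivative fdG r x 2 c) (at r)"
    "((\<lambda>x. fG r x c) has_field_derivative fdG r x 3 c) (at x)" by blast+
qed

definition w where "w = inverse (Xi a \<Lambda>)"

definition cE :: "real \<Rightarrow> real \<Rightarrow> 4 \<Rightarrow> 4 \<Rightarrow> real" where
  "cE r \<theta> b i = sel4 b (sel4 i w 0 0 (- (a * sin \<theta> ^ 2 * w))) (sel4 i 0 1 0 0) (sel4 i 0 0 (- sin \<theta>) 0)
     (sel4 i (a * w) 0 0 (- ((r^2 + a^2) * w)))"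

definition cdE :: "4 \<Rightarrow> real \<Rightarrow> real \<Rightarrow> 4 \<Rightarrow> 4 \<Rightarrow> real" where
  "cdE j r \<theta> b i = sel4 j 0 (sel4 b 0 0 0 (sel4 i 0 0 0 (- (2 * r * w))))
     (sel4 b (sel4 i 0 0 0 (- (2 * a * sin \<theta> * cos \<theta> * w))) 0 (sel4 i 0 0 (- cos \<theta>) 0) 0) 0"

definition cddE :: "4 \<Rightarrow> 4 \<Rightarrow> real \<Rightarrow> real \<Rightarrow> 4 \<Rightarrow> 4 \<Rightarrow> real" where
  "cddE k j r \<theta> b i = sel4 k 0 (sel4 j 0 (sel4 b 0 0 0 (sel4 i 0 0 0 (- (2 * w)))) 0 0)
     (sel4 j 0 0 (sel4 b (sel4 i 0 0 0 (2 * a * w * (sin \<theta> ^ 2 - cos \<theta> ^ 2))) 0 (sel4 i 0 0 (sin \<theta>) 0) 0) 0) 0"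

definition cF :: "real \<Rightarrow> real \<Rightarrow> 4 \<Rightarrow> 4 \<Rightarrow> real" where
  "cF r \<theta> i b = sel4 i (sel4 b ((r^2 + a^2) * Xi a \<Lambda> * fR' r (cos \<theta>)) 0 0 (- (a * sin \<theta> ^ 2 * Xi a \<Lambda> * fR' r (cos \<theta>))))
     (sel4 b 0 1 0 0) (sel4 b 0 0 (- inverse (sin \<theta>)) 0) (sel4 b (a * Xi a \<Lambda> * fR' r (cos \<theta>)) 0 0 (- (Xi a \<Lambda> * fR' r (cos \<theta>))))"

definition cFr :: "real \<Rightarrow> real \<Rightarrow> 4 \<Rightarrow> 4 \<Rightarrow> real" where
  "cFr r \<theta> i b = sel4 i (sel4 b (2 * r * Xi a \<Lambda> * fR' r (cos \<theta>) - (r^2 + a^2) * Xi a \<Lambda> * (2 * r * fR' r (cos \<theta>) ^ 2)) 0 0 (a * sin \<theta> ^ 2 * Xi a \<Lambda> * (2 * r * fR' r (cos \<theta>) ^ 2)))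
     0 0 (sel4 b (- (a * Xi a \<Lambda> * (2 * r * fR' r (cos \<theta>) ^ 2))) 0 0 (Xi a \<Lambda> * (2 * r * fR' r (cos \<theta>) ^ 2)))"

definition cFt :: "real \<Rightarrow> real \<Rightarrow> 4 \<Rightarrow> 4 \<Rightarrow> real" where
  "cFt r \<theta> i b = (let R1 = 2 * a^2 * cos \<theta> * sin \<theta> * fR' r (cos \<theta>) ^ 2 in
     sel4 i (sel4 b ((r^2 + a^2) * Xi a \<Lambda> * R1) 0 0 (- (2 * a * sin \<theta> * cos \<theta> * Xi a \<Lambda> * fR' r (cos \<theta>)) - a * sin \<theta> ^ 2 * Xi a \<Lambda> * R1))
     0 (sel4 b 0 0 (cos \<theta> * inverse (sin \<theta>) ^ 2) 0) (sel4 b (a * Xi a \<Lambda> * R1) 0 0 (- (Xi a \<Lambda> * R1))))"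

lemma cE_deriv:
  "((\<lambda>r. cE r \<theta> b i) has_field_derivative cdE 2 r \<theta> b i) (at r)"
  "((\<lambda>\<theta>. cE r \<theta> b i) has_field_derivative cdE 3 r \<theta> b i) (at \<theta>)"
proof -
  have "\<forall>b i. ((\<lambda>r. cE r \<theta> b i) has_field_derivative cdE 2 r \<theta> b i) (at r)"
    "\<forall>b i. ((\<lambda>\<theta>. cE r \<theta> b i) has_field_derivative cdE 3 r \<theta> b i) (at \<theta>)"
    unfolding forall_4
    by (intro conjI; simp only: cE_def cdE_def sel4_simps cong: sel4_cong;
        rule DERIV_cong, (rule DERIV_ring DERIV_sin)+, simp)+
  then show "((\<lambda>r. cE r \<theta> b i) has_field_derivative cdE 2 r \<theta> b i) (at r)"
    "((\<lambda>\<theta>. cE r \<theta> b i) has_field_derivative cdE 3 r \<theta> b i) (at \<theta>)" by blast+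
qed

lemma cdE_deriv:
  "((\<lambda>r. cdE j r \<theta> b i) has_field_derivative cddE 2 j r \<theta> b i) (at r)"
  "((\<lambda>\<theta>. cdE j r \<theta> b i) has_field_derivative cddE 3 j r \<theta> b i) (at \<theta>)"
proof -
  have "\<forall>j b i. ((\<lambda>r. cdE j r \<theta> b i) has_field_derivative cddE 2 j r \<theta> b i) (at r)"
    "\<forall>j b i. ((\<lambda>\<theta>. cdE j r \<theta> b i) has_field_derivative cddE 3 j r \<theta> b i) (at \<theta>)"
    unfolding forall_4
    by (intro conjI; simp only: cdE_def cddE_def sel4_simps cong: sel4_cong;
        rule DERIV_cong, (rule DERIV_ring DERIV_sin DERIV_cos)+, simp add: algebra_simps power2_eq_square)+
  then show "((\<lambda>r. cdE j r \<theta> b i) has_field_derivative cddE 2 j r \<theta> b i) (at r)"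
    "((\<lambda>\<theta>. cdE j r \<theta> b i) has_field_derivative cddE 3 j r \<theta> b i) (at \<theta>)" by blast+
qed

lemma cF_deriv:
  assumes "fR r (cos \<theta>) \<noteq> 0" "fQ r \<noteq> 0" "fX (cos \<theta>) \<noteq> 0" "sin \<theta> \<noteq> 0"
  shows "((\<lambda>r. cF r \<theta> i b) has_field_derivative cFr r \<theta> i b) (at r)"
    "((\<lambda>\<theta>. cF r \<theta> i b) has_field_derivative cFt r \<theta> i b) (at \<theta>)"
proof -
  note dR = DERIV_chain2[where f = "\<lambda>x. fR' r x" and g = cos, OF deriv_x(2)[OF assms(1,3)] DERIV_cos]
  note ds = DERIV_inverse_fun[OF DERIV_sin assms(4)]
  have "\<forall>i b. ((\<lambda>r. cF r \<theta> i b) has_field_derivative cFr r \<theta> i b) (at r)"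
    unfolding forall_4
    by (intro conjI; simp only: cF_def cFr_def sel4_simps cong: sel4_cong;
        rule DERIV_cong, (rule DERIV_ring deriv_r[OF assms(1,2)])+, simp add: algebra_simps power2_eq_square)
  moreover have "\<forall>i b. ((\<lambda>\<theta>. cF r \<theta> i b) has_field_derivative cFt r \<theta> i b) (at \<theta>)"
    unfolding forall_4
    by (intro conjI; simp only: cF_def cFt_def sel4_simps Let_def cong: sel4_cong;
        rule DERIV_cong, (rule dR ds DERIV_ring DERIV_sin DERIV_cos)+, simp add: algebra_simps power2_eq_square)
  ultimately show "((\<lambda>r. cF r \<theta> i b) has_field_derivative cFr r \<theta> i b) (at r)"
    "((\<lambda>\<theta>. cF r \<theta> i b) has_field_derivative cFt r \<theta> i b) (at \<theta>)" by blast+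
qed

end

context kn_point begin

lemma divide_G4:
  "z / G4 1 = - (z * (R * Q'))" "z / G4 2 = z * (Q * R')" "z / G4 3 = z * (X * R')" "z / G4 4 = z * (R * X')"
  unfolding frame_metric_def sel4_simps using RR' QQ' XX' nz by (simp_all add: field_simps)

lemma connection_contraction:
  "(\<Sum>e\<in>UNIV. (g4 e 1 4 * g4 e 2 3 - g4 e 1 3 * g4 e 2 4) / G4 e) = - 2 * (Q - a^2 * X) * (a * r * x) * R'^3"
  "(\<Sum>e\<in>UNIV. ((g4 e 2 3)\<^sup>2 / (G4 1 * G4 3) + (g4 e 2 4)\<^sup>2 / (G4 1 * G4 4)
      + (g4 e 1 3)\<^sup>2 / (G4 2 * G4 3) + (g4 e 1 4)\<^sup>2 / (G4 2 * G4 4)) / G4 e) = - 2 * (Q - a^2 * X) * (r^2 - a^2 * x^2) * R'^3"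
  unfolding sum_4 divide_divide_eq_left[symmetric] divide_G4
  by (simp only: connection_def sel4_simps cong: sel4_cong; simp add: algebra_simps power2_eq_square power3_eq_cube inverse_cancel)+

end

context kerr_newman begin

definition chart :: "(real^4) set" where
  "chart = {y. fR (y $ 2) (cos (y $ 3)) \<noteq> 0 \<and> fQ (y $ 2) \<noteq> 0 \<and> fX (cos (y $ 3)) \<noteq> 0 \<and> 0 < sin (y $ 3)}"

lemma open_chart: "open chart"
proof -
  have *: "chart = {y. fR (y $ 2) (cos (y $ 3)) \<noteq> 0} \<inter> {y. fQ (y $ 2) \<noteq> 0} \<inter> {y. fX (cos (y $ 3)) \<noteq> 0} \<inter> {y. 0 < sin (y $ 3)}"
    by (auto simp: chart_def)
  show ?thesis unfolding * fR_def fQ_def fX_def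
    by (intro open_Int open_Collect_neq open_Collect_less continuous_intros)
qed

definition "E y = cE (y $ 2) (y $ 3)"
definition "dE y j = cdE j (y $ 2) (y $ 3)"
definition "ddE y k j = cddE k j (y $ 2) (y $ 3)"
definition "F y = cF (y $ 2) (y $ 3)"
definition "dF y j i b = sel4 j 0 (cFr (y $ 2) (y $ 3) i b) (cFt (y $ 2) (y $ 3) i b) 0"
definition "G y = fG (y $ 2) (cos (y $ 3))"
definition "dG y = fdG (y $ 2) (cos (y $ 3))"
definition "conn y = \<gamma> (y $ 2) (cos (y $ 3))"
definition "dconn y f e c d = sel4 f 0 (\<gamma>r (y $ 2) (cos (y $ 3)) e c d) (\<gamma>x (y $ 2) (cos (y $ 3)) e c d) 0"

lemma sel4_eta: "sel4 j (f 1) (f 2) (f 3) (f 4) = f j"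
  using exhaust_4[of j] by (auto simp: sel4_simps)

text \<open>Along the frame, \<open>\<partial>/\<partial>\<theta>\<close> is \<open>- sin \<theta>\<close> times the third frame derivative, so partial derivatives of
  functions of \<open>r\<close> and \<open>cos \<theta>\<close> need no trigonometry.\<close>

lemma has_partial_r_cos:
  assumes "((\<lambda>r. h r (cos (y $ 3))) has_field_derivative D2) (at (y $ 2))"
    and "((\<lambda>x. h (y $ 2) x) has_field_derivative D3) (at (cos (y $ 3)))"
  shows "has_partial (\<lambda>y. h (y $ 2) (cos (y $ 3))) (\<Sum>e\<in>UNIV. E y e j * sel4 e 0 D2 D3 0) j y"
proof -
  have D: "((\<lambda>\<theta>. h (y $ 2) (cos \<theta>)) has_field_derivative D3 * (- sin (y $ 3))) (at (y $ 3))"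
    by (rule DERIV_chain2[OF assms(2) DERIV_cos])
  have "\<forall>j. sel4 j 0 D2 (D3 * (- sin (y $ 3))) 0 = (\<Sum>e\<in>UNIV. E y e j * sel4 e 0 D2 D3 0)"
    unfolding forall_4 by (simp add: sum_4 sel4_simps E_def cE_def)
  then show ?thesis
    using has_partial_r_theta[of "\<lambda>r \<theta>. h r (cos \<theta>)", OF assms(1) D, of j] by simp
qed

lemma kn_frame: "oriented_frame (kn_metric a m q \<Lambda>) chart E dE ddE F dF G dG conn dconn"
proof
  show "open chart" by (rule open_chart)
next
  fix y :: "real^4" and a' b c d e f i j k :: 4
  assume y: "y \<in> chart"
  define r \<theta> x where "r = y $ 2" "\<theta> = y $ 3" "x = cos \<theta>"
  note rx = this
  have nz: "fR r x \<noteq> 0" "fQ r \<noteq> 0" "fX x \<noteq> 0" and s: "0 < sin \<theta>"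
    using y by (auto simp: chart_def rx)
  interpret kn_point a m q L r x "fQ r" "fQ' r" "fQ1 r" "fQ2 r" "fX x" "fX' x" "fX1 x" "fX2 x" "fR r x" "fR' r x" "fP r x" "fN r x"
    by (rule kn_point_fields[OF nz])
  have w: "w * Xi a \<Lambda> = 1" "Xi a \<Lambda> * w = 1" using Xi_nonzero by (simp_all add: w_def)
  have sc: "sin \<theta> ^ 2 = 1 - x^2" using sin_squared_eq[of \<theta>] by (simp add: rx)
  have K: "r^2 + a^2 = fR r x + a^2 * sin \<theta> ^ 2" unfolding sc R by algebra
  show "has_partial (\<lambda>y. E y b i) (dE y j b i) j y"
    using has_partial_r_theta[of "\<lambda>r \<theta>. cE r \<theta> b i", OF cE_deriv, of j]
    by (simp add: E_def dE_def cdE_def sel4_simps sel4_eta[of j])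
  show "has_partial (\<lambda>y. dE y j b i) (ddE y k j b i) k y"
    using has_partial_r_theta[of "\<lambda>r \<theta>. cdE j r \<theta> b i", OF cdE_deriv, of k]
    by (simp add: dE_def ddE_def cddE_def sel4_simps)
  have "\<forall>k j b i. ddE y k j b i = ddE y j k b i"
    unfolding forall_4 by (simp add: ddE_def cddE_def sel4_simps cong: sel4_cong)
  then show "ddE y k j b i = ddE y j k b i" by blast
  show "has_partial (\<lambda>y. F y i b) (dF y j i b) j y"
    unfolding F_def dF_def using nz s
    by (intro has_partial_r_theta[of "\<lambda>r \<theta>. cF r \<theta> i b"] cF_deriv) (auto simp: rx)
  show "has_partial (\<lambda>y. G y b) (\<Sum>e\<in>UNIV. E y e j * dG y e b) j y"
  proof -
    have "\<forall>e. dG y e b = sel4 e 0 (fdG r x 2 b) (fdG r x 3 b) 0"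
      unfolding forall_4 by (simp add: dG_def dG4_def sel4_simps flip: rx)
    then have *: "dG y e b = sel4 e 0 (fdG r x 2 b) (fdG r x 3 b) 0" for e by blast
    show ?thesis
      unfolding G_def * unfolding rx using nz
      by (intro has_partial_r_cos[of "\<lambda>r x. fG r x b"] fG_deriv) (auto simp: rx)
  qed
  show "has_partial (\<lambda>y. conn y e c d) (\<Sum>f\<in>UNIV. E y f j * dconn y f e c d) j y"
    unfolding conn_def dconn_def using nz
    by (intro has_partial_r_cos[of "\<lambda>r x. \<gamma> r x e c d"] connection_deriv_r connection_deriv_x) (auto simp: rx)
  show "(if c = d then dG y e c else 0) = G y c * conn y e c d + G y d * conn y e d c"
    unfolding dG_def G_def conn_def rx(1,2)[symmetric] rx(3)[symmetric] by (rule adapted.comp[OF adapted_G4])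
  show "G y b \<noteq> 0" using G4_nonzero[of b] by (simp add: G_def rx)
  show "G y 1 * G y 2 * G y 3 * G y 4 = - 1"
    using adapted.G12[OF adapted_G4] adapted.G34[OF adapted_G4] by (simp add: G_def rx)
  show "kn_metric a m q \<Lambda> y $ i $ j = (\<Sum>b\<in>UNIV. G y b * E y b i * E y b j)"
  proof -
    define T where "T = 1 + a^2 * L * x^2"
    have T: "fX x = sin \<theta> ^ 2 * T" "Delta_theta a \<Lambda> \<theta> = T"
      unfolding fX_def sc T_def Delta_theta_def L_def rx(3) by simp_all
    have T': "T \<noteq> 0" "fX' x * sin \<theta> ^ 2 = inverse T"
      using nz(3) s by (auto simp: fX'_def T(1))
    have D: "Delta_r a m q \<Lambda> r = fQ r" "rho_sq a r \<theta> = fR r x"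
      by (simp_all add: Delta_r_def fQ_def L_def rho_sq_def fR_def rx[symmetric])
    have "\<forall>i j. kn_metric a m q \<Lambda> y $ i $ j = (\<Sum>b\<in>UNIV. G y b * E y b i * E y b j)"
      unfolding forall_4 kn_metric_def Let_def G_def E_def rx[symmetric] D T(2)
      apply (intro conjI)
      apply (simp_all add: sum_4 frame_metric_def cE_def sel4_simps axis_def vector_4 cong: sel4_cong)
      apply (simp_all add: T(1) fR'_def fQ'_def w_def divide_inverse power2_eq_square)
      apply (simp_all add: T'(2)[symmetric] power2_eq_square)
      apply (simp_all add: algebra_simps)
      done
    then show ?thesis by blast
  qed
  show "(\<Sum>b\<in>UNIV. F y i b * E y b j) = (if i = j then 1 else 0)"
  proof -
    have "\<forall>i j. (\<Sum>b\<in>UNIV. F y i b * E y b j) = (if i = j then 1 else 0)"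
      unfolding forall_4 F_def E_def rx[symmetric]
      by (intro conjI; simp add: sum_4 cF_def cE_def sel4_simps cong: sel4_cong;
         (use s in simp; fail | (use w(1) RR' R sc in \<open>simp only: rx[symmetric]; algebra\<close>)))
    then show ?thesis by blast
  qed
  show "dE y i c j - dE y j c i = - (\<Sum>e\<in>UNIV. \<Sum>f\<in>UNIV. E y e i * E y f j * (conn y e c f - conn y f c e))"
  proof -
    define tA tB tC tD where "tA = sel4 c (- 2 * a^2 * x * fR' r x) 0 0 0" "tB = sel4 c (2 * a * x * fR' r x) 0 0 0"
      "tC = sel4 c 0 0 0 (2 * a * r * fR' r x)" "tD = sel4 c 0 0 0 (- 2 * r * fR' r x)"
    note t = this
    have "\<forall>c e f. g4 e c f - g4 f c e = sel4 c (- 2 * a^2 * x * fR' r x) 0 0 0 * wedge 3 1 e f + sel4 c (2 * a * x * fR' r x) 0 0 0 * wedge 3 4 e f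
        + sel4 c 0 0 0 (2 * a * r * fR' r x) * wedge 2 1 e f + sel4 c 0 0 0 (- 2 * r * fR' r x) * wedge 2 4 e f"
      unfolding forall_4
      by (intro conjI; simp only: connection_def sel4_simps cong: sel4_cong; simp add: wedge_def delta_def)
    then have g: "g4 e c f - g4 f c e = tA * wedge 3 1 e f + tB * wedge 3 4 e f + tC * wedge 2 1 e f + tD * wedge 2 4 e f" for e f
      unfolding t by blast
    have "(\<Sum>e\<in>UNIV. \<Sum>f\<in>UNIV. cE r \<theta> e i * cE r \<theta> f j * (g4 e c f - g4 f c e)) =
      tA * (\<Sum>e\<in>UNIV. \<Sum>f\<in>UNIV. wedge 3 1 e f * (cE r \<theta> e i * cE r \<theta> f j))
      + tB * (\<Sum>e\<in>UNIV. \<Sum>f\<in>UNIV. wedge 3 4 e f * (cE r \<theta> e i * cE r \<theta> f j))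
      + tC * (\<Sum>e\<in>UNIV. \<Sum>f\<in>UNIV. wedge 2 1 e f * (cE r \<theta> e i * cE r \<theta> f j))
      + tD * (\<Sum>e\<in>UNIV. \<Sum>f\<in>UNIV. wedge 2 4 e f * (cE r \<theta> e i * cE r \<theta> f j))"
      unfolding g by (simp add: sum_distrib_left sum.distrib distrib_left mult_ac)
    moreover have "\<forall>c i j. cdE i r \<theta> c j - cdE j r \<theta> c i = - (
        sel4 c (- 2 * a^2 * x * fR' r x) 0 0 0 * (cE r \<theta> 3 i * cE r \<theta> 1 j - cE r \<theta> 1 i * cE r \<theta> 3 j)
      + sel4 c (2 * a * x * fR' r x) 0 0 0 * (cE r \<theta> 3 i * cE r \<theta> 4 j - cE r \<theta> 4 i * cE r \<theta> 3 j)
      + sel4 c 0 0 0 (2 * a * r * fR' r x) * (cE r \<theta> 2 i * cE r \<theta> 1 j - cE r \<theta> 1 i * cE r \<theta> 2 j)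
      + sel4 c 0 0 0 (- 2 * r * fR' r x) * (cE r \<theta> 2 i * cE r \<theta> 4 j - cE r \<theta> 4 i * cE r \<theta> 2 j))"
      unfolding forall_4
      by (intro conjI; simp only: cdE_def cE_def sel4_simps flip: rx(3) cong: sel4_cong;
         (simp add: power2_eq_square; fail | (simp only: K, use RR' in algebra)))
    ultimately have "dE y i c j - dE y j c i = - (\<Sum>e\<in>UNIV. \<Sum>f\<in>UNIV. E y e i * E y f j * (conn y e c f - conn y f c e))"
      unfolding dE_def E_def conn_def rx(1,2)[symmetric] rx(3)[symmetric] sum_sum_wedge t by (simp only: mult.commute)
    then show ?thesis .
  qed
  have "det (\<chi> b i. E y b i) = w^2 * (sin \<theta> * fR r x)"
    unfolding E_def rx[symmetric]
    by (simp add: det_4 cE_def sel4_simps K cong: sel4_cong) (simp add: algebra_simps power2_eq_square)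
  moreover have "0 < fR r x" using nz(1) sum_power2_gt_zero_iff[of r "a * x"] by (auto simp: fR_def power_mult_distrib)
  ultimately show "0 < det (\<chi> b i. E y b i)"
    using s w by (auto intro!: mult_pos_pos)
qed

interpretation fr: oriented_frame "kn_metric a m q \<Lambda>" chart E dE ddE F dF G dG conn dconn
  by (rule kn_frame)

definition "P y = fP (y $ 2) (cos (y $ 3))"
definition "N y = fN (y $ 2) (cos (y $ 3))"
definition "dP y e = sel4 e 0 (fPr (y $ 2) (cos (y $ 3))) (fPx (y $ 2) (cos (y $ 3))) 0"
definition "dN y e = sel4 e 0 (fNr (y $ 2) (cos (y $ 3))) (fNx (y $ 2) (cos (y $ 3))) 0"

lemma chart_point:
  assumes "y \<in> chart"
  shows "kn_point a m q L (y $ 2) (cos (y $ 3)) (fQ (y $ 2)) (fQ' (y $ 2)) (fQ1 (y $ 2)) (fQ2 (y $ 2))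
    (fX (cos (y $ 3))) (fX' (cos (y $ 3))) (fX1 (cos (y $ 3))) (fX2 (cos (y $ 3)))
    (fR (y $ 2) (cos (y $ 3))) (fR' (y $ 2) (cos (y $ 3))) (P y) (N y)"
  using assms unfolding P_def N_def by (intro kn_point_fields) (auto simp: chart_def)

lemma has_partial_PN:
  assumes "y \<in> chart"
  shows "has_partial P (\<Sum>e\<in>UNIV. E y e j * dP y e) j y" "has_partial N (\<Sum>e\<in>UNIV. E y e j * dN y e) j y"
  using assms unfolding P_def[abs_def] N_def[abs_def] dP_def dN_def
  by (intro has_partial_r_cos[of fP] has_partial_r_cos[of fN] PN_deriv; simp add: chart_def)+

lemma adapted_point: "y \<in> chart \<Longrightarrow> adapted (G y) (dG y e) (conn y e)"
  unfolding G_def dG_def conn_def using kn_point.adapted_G4[OF chart_point] .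

lemma weyl_frame_eq:
  assumes y: "y \<in> chart"
  shows "fr.weyl_frame y = typeD (G y) (P y) (N y)"
proof -
  interpret kn_point a m q L "y $ 2" "cos (y $ 3)" "fQ (y $ 2)" "fQ' (y $ 2)" "fQ1 (y $ 2)" "fQ2 (y $ 2)"
    "fX (cos (y $ 3))" "fX' (cos (y $ 3))" "fX1 (cos (y $ 3))" "fX2 (cos (y $ 3))"
    "fR (y $ 2) (cos (y $ 3))" "fR' (y $ 2) (cos (y $ 3))" "P y" "N y"
    by (rule chart_point[OF y])
  have curv: "fr.curv y = curv4"
    by (simp add: fun_eq_iff fr.curv_def curv4_def dconn_def dg4_def conn_def)
  have ric: "fr.ric y = ric4" by (simp add: fun_eq_iff fr.ric_def curv ric4_eq)
  have scal: "fr.scal y = 12 * L" by (simp add: fr.scal_def ric G_def scal4_eq)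
  show ?thesis
    unfolding fun_eq_iff fr.weyl_frame_def Let_def curv ric scal G_def weyl4_eq by simp
qed

lemma has_partial_typeD:
  assumes y: "y \<in> chart"
    and p: "has_partial p (\<Sum>e\<in>UNIV. E y e u * p' e) u y" and n: "has_partial n (\<Sum>e\<in>UNIV. E y e u * n' e) u y"
  shows "has_partial (\<lambda>y. typeD (G y) (p y) (n y) b c d e)
     (\<Sum>h\<in>UNIV. E y h u * partial_typeD (G y) (dG y h) (p y) (n y) (p' h) (n' h) b c d e) u y"
  unfolding typeD_def
  by (rule has_partial_eq_rhs, (rule partial_intros p n fr.dG[OF y])+)
     (simp add: sum_4 partial_typeD_def typeD_def algebra_simps)

lemma cov_deriv_typeD:
  assumes y: "y \<in> chart"
    and T: "\<And>z i j k l. z \<in> chart \<Longrightarrow> T z i j k l = pull (E z) (typeD (G z) (p z) (n z)) i j k l"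
    and p: "\<And>u. has_partial p (\<Sum>e\<in>UNIV. E y e u * p' e) u y" and n: "\<And>u. has_partial n (\<Sum>e\<in>UNIV. E y e u * n' e) u y"
  shows "cov_deriv (kn_metric a m q \<Lambda>) T y u i j k l =
     contract (\<lambda>e. E y e u) (\<lambda>e. pull (E y) (nabla_typeD (G y) (conn y e) (p y) (n y) (p' e) (n' e)) i j k l)"
proof -
  have "fr.cov_frame y (typeD (G y) (p y) (n y)) (\<lambda>e. partial_typeD (G y) (dG y e) (p y) (n y) (p' e) (n' e)) e =
     nabla_typeD (G y) (conn y e) (p y) (n y) (p' e) (n' e)" for e
    unfolding fun_eq_iff fr.cov_frame_def adapted.derivation_typeD[OF adapted_point[OF y]] by simp
  then show ?thesis
    using fr.cov_deriv_eq[OF y T, where dt = "\<lambda>e. partial_typeD (G y) (dG y e) (p y) (n y) (p' e) (n' e)",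
        OF _ has_partial_typeD[OF y p n]] by simp
qed

lemma I4_kn:
  assumes y: "y \<in> chart"
  shows "I4 (kn_metric a m q \<Lambda>) y = (\<Sum>e\<in>UNIV. (- 96 * dP y e * dN y e + 144 * (((P y)\<^sup>2 - (N y)\<^sup>2) * (2 * (conn y e 1 4 * conn y e 2 3 - conn y e 1 3 * conn y e 2 4))
       + 2 * P y * N y * ((conn y e 2 3)\<^sup>2 / (G y 1 * G y 3) + (conn y e 2 4)\<^sup>2 / (G y 1 * G y 4)
          + (conn y e 1 3)\<^sup>2 / (G y 2 * G y 3) + (conn y e 1 4)\<^sup>2 / (G y 2 * G y 4)))) / G y e)"
proof -
  have dual: "fr.dual_frame z (typeD (G z) (P z) (N z)) = typeD (G z) (- N z) (P z)" if "z \<in> chart" for z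
    unfolding fun_eq_iff fr.dual_frame_def adapted.dual_typeD[OF adapted_point[OF that]] by simp
  have minus: "has_partial (\<lambda>y. - N y) (\<Sum>e\<in>UNIV. E y e u * - dN y e) u y" for u
    using has_partial_diff[OF has_partial_const[of 0] has_partial_PN(2)[OF y, of u]] by (simp add: sum_negf)
  show ?thesis
    by (subst fr.I4_eq[OF y cov_deriv_typeD[OF y _ has_partial_PN[OF y]] cov_deriv_typeD[OF y _ minus has_partial_PN(1)[OF y]]])
       (simp_all only: fr.weyl_eq weyl_frame_eq fr.dual_weyl_eq dual adapted.contraction_nabla_typeD[OF adapted_point[OF y]])
qed

lemma I4_value:
  fixes y
  defines "r \<equiv> y $ 2" and "x \<equiv> cos (y $ 3)"
  assumes y: "y \<in> chart"
  shows "I4 (kn_metric a m q \<Lambda>) y =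
    (- 96 * (fQ r * fPr r x * fNr r x + fX x * fPx r x * fNx r x)
     - 576 * (fQ r - a^2 * fX x) * ((fP r x ^ 2 - fN r x ^ 2) * (a * r * x) + fP r x * fN r x * (r^2 - a^2 * x^2)) * fR' r x ^ 2) * fR' r x"
proof -
  interpret kn_point a m q L r x "fQ r" "fQ' r" "fQ1 r" "fQ2 r" "fX x" "fX' x" "fX1 x" "fX2 x" "fR r x" "fR' r x" "fP r x" "fN r x"
    using chart_point[OF y] by (simp add: P_def N_def r_def x_def)
  have G: "G y = G4" "conn y = g4" by (simp_all add: G_def conn_def r_def x_def)
  define A where "A e = g4 e 1 4 * g4 e 2 3 - g4 e 1 3 * g4 e 2 4" for e
  define B where "B e = (g4 e 2 3)\<^sup>2 / (G4 1 * G4 3) + (g4 e 2 4)\<^sup>2 / (G4 1 * G4 4)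
          + (g4 e 1 3)\<^sup>2 / (G4 2 * G4 3) + (g4 e 1 4)\<^sup>2 / (G4 2 * G4 4)" for e
  have "I4 (kn_metric a m q \<Lambda>) y = - 96 * (\<Sum>e\<in>UNIV. dP y e * dN y e / G4 e)
     + 144 * ((P y)\<^sup>2 - (N y)\<^sup>2) * 2 * (\<Sum>e\<in>UNIV. A e / G4 e) + 144 * 2 * P y * N y * (\<Sum>e\<in>UNIV. B e / G4 e)"
    unfolding I4_kn[OF y] G A_def[symmetric] B_def[symmetric] sum_distrib_left sum.distrib[symmetric]
    by (rule sum.cong[OF refl]) (simp add: add_divide_distrib diff_divide_distrib algebra_simps)
  also have "(\<Sum>e\<in>UNIV. A e / G4 e) = - 2 * (fQ r - a^2 * fX x) * (a * r * x) * fR' r x ^3"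
    unfolding A_def by (rule connection_contraction)
  also have "(\<Sum>e\<in>UNIV. B e / G4 e) = - 2 * (fQ r - a^2 * fX x) * (r^2 - a^2 * x^2) * fR' r x ^3"
    unfolding B_def by (rule connection_contraction)
  also have "(\<Sum>e\<in>UNIV. dP y e * dN y e / G4 e) = (fQ r * fPr r x * fNr r x + fX x * fPx r x * fNx r x) * fR' r x"
    unfolding sum_4 divide_G4 dP_def dN_def r_def[symmetric] x_def[symmetric] sel4_simps by algebra
  finally show ?thesis
    unfolding P_def N_def r_def[symmetric] x_def[symmetric] by algebra
qed

end

theorem theorem13:
  fixes a m q \<Lambda> t r \<theta> \<phi> c :: real
  assumes "rho_sq a r \<theta> \<noteq> 0"
    and "Delta_r a m q \<Lambda> r \<noteq> 0"
    and "Delta_theta a \<Lambda> \<theta> > 0"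
    and "Xi a \<Lambda> \<noteq> 0"
    and "0 < \<theta>" and "\<theta> < pi"
    and "c = cos \<theta>"
  shows "I4 (kn_metric a m q \<Lambda>) (vector [t, r, \<theta>, \<phi>]) =
    1920 * a * c / (r^2 + a^2 * c^2)^9 * (
      a^10 * m * \<Lambda> * (m * r - 3 * q^2 / 10) * c^10
    - a^8 * (7 * \<Lambda> * m^2 * r^3 - 57 * \<Lambda> * m * q^2 * r^2 / 10
        + (a^2 * m^2 * \<Lambda> + 29/30 * q^4 * \<Lambda> - 3 * m^2) * r
        - 3 * m * q^2 * (\<Lambda> * a^2 - 3) / 10) * c^8
    + 6 * a^6 * (\<Lambda> * m^2 * r^5 - 83 * m * q^2 * r^4 * \<Lambda> / 60
        + (a^2 * m^2 * \<Lambda> + 37/90 * q^4 * \<Lambda> - 3 * m^2) * r^3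
        - 11 * (a^2 * \<Lambda> * q^2 + 12/11 * m^2 - 3 * q^2) * m * r^2 / 12
        + 29 * (a^2 * \<Lambda> * q^2 + 126/29 * m^2 - 3 * q^2) * q^2 * r / 180
        + m * q^2 * (a^2 - 2 * q^2) / 20) * c^6
    + 37 * a^4 * r / 10 * (60 * \<Lambda> * m^2 * r^6 / 37 - 33 * r^5 * m * q^2 * \<Lambda> / 37
        + m * (a^2 * \<Lambda> * q^2 + 420/37 * m^2 - 3 * q^2) * r^3
        - 19 * (a^2 * \<Lambda> * q^2 + 498/19 * m^2 - 3 * q^2) * q^2 * r^2 / 37
        - 27 * (a^2 - 178 * q^2 / 27) * m * q^2 * r / 37
        + 12 * q^4 * a^2 / 37 - 17 * q^6 / 37) * c^4
    - 6 * a^2 * r^3 * (7 * \<Lambda> * m^2 * r^6 / 6 - 3 * r^5 * m * q^2 * \<Lambda> / 2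
        + (a^2 * m^2 * \<Lambda> + 37/90 * q^4 * \<Lambda> - 3 * m^2) * r^4
        - 5 * m * (a^2 * \<Lambda> * q^2 - 28/5 * m^2 - 3 * q^2) * r^3 / 4
        + 19 * (a^2 * \<Lambda> * q^2 - 750/19 * m^2 - 3 * q^2) * q^2 * r^2 / 60
        + (a^2 + 418 * q^2 / 15) * m * q^2 * r / 4
        - 37 * q^6 / 30) * c^2
    + r^5 * (\<Lambda> * m^2 * r^6 - 2 * r^5 * m * q^2 * \<Lambda>
        + (a^2 * m^2 * \<Lambda> + 29/30 * q^4 * \<Lambda> - 3 * m^2) * r^4
        - 2 * m * (a^2 * \<Lambda> * q^2 - 3 * m^2 - 3 * q^2) * r^3
        + (29/30 * a^2 * q^4 * \<Lambda> - 15 * m^2 * q^2 - 29/10 * q^4) * r^2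
        + 3 * m * q^2 * (a^2 + 118 * q^2 / 15) * r / 2
        - 6 * q^4 * a^2 / 5 - 29 * q^6 / 10))"
proof -
  interpret kerr_newman a m q \<Lambda> by unfold_locales fact
  define y :: "real^4" where "y = vector [t, r, \<theta>, \<phi>]"
  have y: "y $ 2 = r" "y $ 3 = \<theta>" by (simp_all add: y_def vector_4)
  have s: "0 < sin \<theta>" using assms(5,6) by (rule sin_gt_zero)
  have X: "fX c = sin \<theta> ^ 2 * Delta_theta a \<Lambda> \<theta>"
    by (simp add: fX_def L_def Delta_theta_def assms(7) sin_squared_eq)
  have chart: "y \<in> chart"
    using assms(1,2,3) s X
    by (simp add: chart_def y assms(7)[symmetric] rho_sq_def fR_def Delta_r_def fQ_def L_def)
  have L: "3 * L = \<Lambda>" by (simp add: L_def)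
  have "I4 (kn_metric a m q \<Lambda>) y = (- 96 * (fQ r * fPr r c * fNr r c + fX c * fPx r c * fNx r c)
     - 576 * (fQ r - a^2 * fX c) * ((fP r c ^ 2 - fN r c ^ 2) * (a * r * c) + fP r c * fN r c * (r^2 - a^2 * c^2)) * fR' r c ^ 2) * fR' r c"
    using I4_value[OF chart] by (simp only: y assms(7)[symmetric])
  also have "\<dots> = fR' r c ^ 9 *
    (- 96 * (fQ r * (fpr r c * fR r c - 6 * r * fp r c) * (fnr r c * fR r c - 6 * r * fn r c)
        + fX c * (fpx r c * fR r c - 6 * a^2 * c * fp r c) * (fnx r c * fR r c - 6 * a^2 * c * fn r c))
    - 576 * (fQ r - a^2 * fX c) * ((fp r c ^ 2 - fn r c ^ 2) * (a * r * c) + fp r c * fn r c * (r^2 - a^2 * c^2)))"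
    unfolding fP_def fN_def fPr_def fPx_def fNr_def fNx_def by algebra
  also have "fR' r c ^ 9 = 1 / (r^2 + a^2 * c^2)^9" by (simp add: fR'_def fR_def power_inverse divide_inverse)
  also note I4_polynomial_identity[of L r a m q c, folded fQ_def fX_def fR_def fp_def fn_def fpr_def fpx_def fnr_def fnx_def, unfolded L]
  also have "1 / D * (1920 * a * c * z) = 1920 * a * c / D * z" for D z by simp
  finally show ?thesis unfolding y_def .
qed

end
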